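(* (Quarter-temperature contribution for critical RN-AdS black holes.) Let $$\mathcal I(z;\tau,q)=\frac{z+z^3+q^2/z-2\pi\tau z^2}{2\tau},\qquad \rho_E(z,q)=\frac12\left(1+3z^2-\frac{q^2}{z^2}\right),$$ $$z_e(q)^2=\frac{-1+\sqrt{1+12q^2}}{6}\quad(z_e(q)>0),$$ and let $z_c=1/\sqrt6$, $q_c=1/6$, $\tau_c=\sqrt6/(3\pi)$. Then $z_e(q_c)<z_c$, $\rho_E(z,q_c)>0$ for $z>z_e(q_c)$, $\rho_E(z_c,q_c)=2/3$, $\mathcal I(z_c;\tau_c,q_c)=\pi/6$, and with $\delta=z-z_c$, as $\delta\to0$, $$\mathcal I(z_c+\delta;\tau_c,q_c)-\frac\pi6=\frac{3\pi}{2}\delta^4-\frac{3\pi\sqrt6}{2}\delta^5+9\pi\delta^6+\mathcal O(\delta^7).$$ Moreover, for $g>0$ and $s>0$ let $Z_c(s)=\int_{z_e(q_c)}^\infty \rho_E(z,q_c)\,e^{-s\,\mathcal I(z;\tau_c,q_c)/g}\,dz$. Then, for $s$ near $1$, as $g\to0^+$, $$Z_c(s)=e^{-s\pi/(6g)}\cdot\frac23\cdot\frac{\Gamma(1/4)}{2}\left(\frac{2g}{3\pi s}\right)^{1/4}\left[1+\mathcal O(g^{1/2})\right],$$ and the normalized ensemble average $\bar F$ of the generalized free energy at the critical point satisfies $$\frac{\bar F-F_c}{T_c}=\frac14+\mathcal O(g^{1/2}).$$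
   Context: This is the four-dimensional Reissner–Nordström–AdS reduced ensemble with AdS radius $L$, charge $Q$, horizon radius $r$, Newton constant $G_N$ and temperature $T_E$, in the dimensionless variables $g=G_N/L^2$, $z=r/L$, $q=Q/L$, $\tau=LT_E$. The reduced Euclidean action is $I_E=\mathcal I/g$ and the generalized free energy is $F_{\mathrm{gen}}=T_EI_E$. The measure is the dimensionless energy measure $\rho_E\,dz=dm$ with $m=\frac12(z+z^3+q^2/z)$, over the nonextremal branch $z>z_e(q)$. At the critical point $T_E=T_c=\tau_c/L$, $q=q_c$, let $F_c=T_c\,\pi/(6g)$ be the generalized free energy at $z_c$, and let $$\bar F=\frac{\int_{z_e(q_c)}^\infty F_{\mathrm{gen}}\,\rho_E\,e^{-I_E}\,dz}{\int_{z_e(q_c)}^\infty\rho_E\,e^{-I_E}\,dz}=-T_c\frac{d}{ds}\ln Z_c(s)\Big|_{s=1},$$ so that $\bar F/T_c$ is the average of $\mathcal I(z;\tau_c,q_c)/g$. *)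

theory Defs
  imports "HOL-Analysis.Analysis" "HOL-Library.Landau_Symbols"
begin

text \<open>
  Reduced ensemble of the four-dimensional Reissner--Nordstroem--AdS black hole, in the
  dimensionless variables \<open>g = G_N / L\<^sup>2\<close>, \<open>z = r / L\<close>, \<open>q = Q / L\<close>, \<open>\<tau> = L T_E\<close>.
\<close>

definition reduced_action :: "real \<Rightarrow> real \<Rightarrow> real \<Rightarrow> real" where
  "reduced_action z \<tau> q = (z + z^3 + q^2 / z - 2 * pi * \<tau> * z^2) / (2 * \<tau>)"

text \<open>The density of \<open>dm\<close> with respect to \<open>dz\<close>, where \<open>m = (z + z\<^sup>3 + q\<^sup>2 / z) / 2\<close>.\<close>

definition energy_density :: "real \<Rightarrow> real \<Rightarrow> real" where
  "energy_density z q = (1 + 3 * z^2 - q^2 / z^2) / 2"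

definition z_ext :: "real \<Rightarrow> real" where
  "z_ext q = sqrt ((- 1 + sqrt (1 + 12 * q^2)) / 6)"

definition euclidean_action :: "real \<Rightarrow> real \<Rightarrow> real \<Rightarrow> real \<Rightarrow> real" where
  "euclidean_action g \<tau> q z = reduced_action z \<tau> q / g"

text \<open>The factor \<open>\<tau> / L\<close> is the temperature \<open>T_E\<close>.\<close>

definition F_gen :: "real \<Rightarrow> real \<Rightarrow> real \<Rightarrow> real \<Rightarrow> real \<Rightarrow> real" where
  "F_gen L g \<tau> q z = (\<tau> / L) * euclidean_action g \<tau> q z"

definition F_avg :: "real \<Rightarrow> real \<Rightarrow> real \<Rightarrow> real \<Rightarrow> real" where
  "F_avg L g \<tau> q =
     (LBINT z:{z_ext q<..}. F_gen L g \<tau> q z * energy_density z q * exp (- euclidean_action g \<tau> q z)) /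
     (LBINT z:{z_ext q<..}. energy_density z q * exp (- euclidean_action g \<tau> q z))"

definition z_crit :: real where "z_crit = 1 / sqrt 6"
definition q_crit :: real where "q_crit = 1 / 6"
definition \<tau>_crit :: real where "\<tau>_crit = sqrt 6 / (3 * pi)"

definition T_crit :: "real \<Rightarrow> real" where "T_crit L = \<tau>_crit / L"

definition F_crit :: "real \<Rightarrow> real \<Rightarrow> real" where
  "F_crit L g = F_gen L g \<tau>_crit q_crit z_crit"

definition F_bar :: "real \<Rightarrow> real \<Rightarrow> real" where
  "F_bar L g = F_avg L g \<tau>_crit q_crit"

definition Z_crit :: "real \<Rightarrow> real \<Rightarrow> real" where
  "Z_crit g s =
     (LBINT z:{z_ext q_crit<..}.
        energy_density z q_crit * exp (- s * reduced_action z \<tau>_crit q_crit / g))"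

end

(*
  At the critical point the action is pi/6 + (3 pi/2) (z - a)^4 a/z with a = z_crit: the phase is
  exactly quartic up to the factor a/z. Substituting z = a + e t with e = (g/s)^(1/4) turns Z into a
  Gaussian-type integral of exp(-(3 pi/2) t^4) perturbed by powers of e. For e <= 1 everything is
  dominated by a polynomial times exp(-c |t|), and the term linear in e is odd in t, so the relative
  error is e^2 = O(sqrt g). The average of the excess action is the quotient of the moment with
  weight (3 pi/2) t^4 by the zeroth moment, which is Gamma(5/4) / Gamma(1/4) = 1/4.
*)

theory Submission
  imports Defs
begin

text \<open>The phase has neither a quadratic nor a cubic term at \<open>z_crit\<close>, and its
  exact form dictates the estimates. The factor a/z weakens the growth of the quartic at infinity,
  so only a linear exponential rate is extracted; it is uniform in e <= 1 and suffices against
  polynomials. The pole of the factor at z = 0 is harmless because the branch starts at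
  \<open>z_ext q_crit\<close> > 0. The usual splitting into a neighbourhood of the minimum and a
  tail is avoided: amplitude expansions hold on the whole branch, and where the rescaled half-line
  is cut off one has 1 <= (e t / d)^2 with d = \<open>z_crit - z_ext q_crit\<close>, so the missing
  piece also costs only e^2. An asymptotic formula for Z may not be differentiated in s. The mean is
  therefore obtained from a second Laplace integral with its own error bound, while the identity
  with the logarithmic derivative of Z at s = 1 is proved separately, at fixed g. Both integrals fit
  one lemma: in the weight given by the excess action, the factor a/z is moved into the amplitude,
  leaving a pure t^4.\<close>

section \<open>Exponential estimates and quartic Gaussian moments\<close>

text \<open>The factor max 1 (exp y) covers both signs of y; after multiplication by a decaying
  exponential it becomes the larger of the unperturbed and the perturbed decay.\<close>

lemma exp_minus_linear_le:
  fixes y :: real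
  shows "\<bar>exp y - 1 - y\<bar> \<le> y\<^sup>2 / 2 * max 1 (exp y)"
proof -
  have "exp y - 1 - y \<le> y\<^sup>2 / 2 * max 1 (exp y)"
  proof (cases "y \<ge> 0")
    case True
    obtain t where t: "\<bar>t\<bar> \<le> \<bar>y\<bar>" "exp y = (\<Sum>m<2. y ^ m / fact m) + exp t / fact 2 * y ^ 2"
      using Maclaurin_exp_le[of y 2] by blast
    have "exp y - 1 - y = y\<^sup>2 / 2 * exp t"
      using t(2) by (simp add: numeral_2_eq_2)
    also have "\<dots> \<le> y\<^sup>2 / 2 * exp y"
      using t(1) True by (intro mult_left_mono) auto
    also have "\<dots> \<le> y\<^sup>2 / 2 * max 1 (exp y)"
      by (intro mult_left_mono) auto
    finally show ?thesis .
  next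
    case False
    define v where "v = - y"
    have v: "v > 0" "y = - v" using False by (auto simp: v_def)
    have pos: "0 < 1 + v + v\<^sup>2 / 2" using v(1) by (intro add_pos_nonneg) auto
    \<comment> \<open>For y = -v the bound exp v >= 1 + v + v^2/2 is inverted by means of this
      product: the reciprocal of that quadratic is at most 1 - v + v^2/2.\<close>
    have "1 \<le> 1 + v^4 / 4" by simp
    also have "\<dots> = (1 - v + v\<^sup>2 / 2) * (1 + v + v\<^sup>2 / 2)"
      by (simp add: field_simps power2_eq_square power4_eq_xxxx)
    finally have "1 / (1 + v + v\<^sup>2 / 2) \<le> 1 - v + v\<^sup>2 / 2"
      using pos by (simp add: divide_le_eq)
    moreover have "exp y \<le> 1 / (1 + v + v\<^sup>2 / 2)"
      using exp_lower_Taylor_quadratic[of v] v pos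
      by (simp add: exp_minus field_simps)
    ultimately have "exp y - 1 - y \<le> y\<^sup>2 / 2" using v by simp
    then show ?thesis using False by (simp add: max_def)
  qed
  moreover have "exp y - 1 - y \<ge> 0" using exp_ge_add_one_self[of y] by linarith
  ultimately show ?thesis by simp
qed

text \<open>A single term of the exponential series bounds the power. The free rate c lets a power
  be paid for by an arbitrarily small share of an exponential decay.\<close>

lemma power_le_exp:
  fixes c y :: real
  assumes "c > 0" "y \<ge> 0"
  shows "y ^ j \<le> fact j * (1 / c) ^ j * exp (c * y)"
proof -
  obtain t where t: "exp (c * y) = (\<Sum>m<Suc j. (c * y) ^ m / fact m) + exp t / fact (Suc j) * (c * y) ^ Suc j"
    using Maclaurin_exp_le[of "c * y" "Suc j"] by blast
  have "(c * y) ^ j / fact j \<le> (\<Sum>m<Suc j. (c * y) ^ m / fact m)"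
    using assms by (intro member_le_sum) auto
  also have "\<dots> \<le> exp (c * y)" using t assms by simp
  finally have "(c * y) ^ j \<le> fact j * exp (c * y)" by (simp add: field_simps)
  then have "(1 / c) ^ j * (c * y) ^ j \<le> (1 / c) ^ j * (fact j * exp (c * y))"
    using assms by (intro mult_left_mono) auto
  then show ?thesis
    using assms by (simp add: power_mult_distrib power_divide field_simps)
qed

section \<open>Integrability of polynomials against two-sided exponential decay\<close>

lemma integrable_exp_minus_abs:
  fixes c :: real
  assumes "c > 0"
  shows "integrable lborel (\<lambda>t. exp (- c * \<bar>t\<bar>))"
proof -
  let ?h = "\<lambda>t. indicator {0..} t * exp (- c * t) :: real"
  have "(\<lambda>t. exp (- c * t)) absolutely_integrable_on {0..}"
    using integrable_on_exp_minus_to_infinity[OF assms, of 0]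
    by (intro nonnegative_absolutely_integrable_1) auto
  then have h: "integrable lborel ?h"
    by (simp add: set_integrable_def integrable_completion)
  \<comment> \<open>The two halves overlap at t = 0, where the sum is 2; it therefore serves as a
    dominating function and not as an identity.\<close>
  have "integrable lborel (\<lambda>t. ?h t + ?h (- t))"
    using h lborel_integrable_real_affine[OF h, of "-1" 0] by (intro Bochner_Integration.integrable_add) auto
  then show ?thesis
    by (rule Bochner_Integration.integrable_bound) (auto simp: indicator_def intro!: AE_I2)
qed

lemma integrable_poly_exp_minus_abs:
  fixes c :: real
  assumes "c > 0"
  shows "integrable lborel (\<lambda>t. poly p \<bar>t\<bar> * exp (- c * \<bar>t\<bar>))"
proof -
  have mono: "integrable lborel (\<lambda>t. \<bar>t\<bar> ^ j * exp (- c * \<bar>t\<bar>))" for j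
  proof (rule Bochner_Integration.integrable_bound)
    \<comment> \<open>Half of the rate absorbs the power, the other half keeps the bound
      integrable.\<close>
    show "integrable lborel (\<lambda>t. fact j * (1 / (c/2)) ^ j * exp (- (c/2) * \<bar>t\<bar>))"
      using assms by (intro integrable_mult_right integrable_exp_minus_abs) simp
    show "AE t in lborel. norm (\<bar>t\<bar> ^ j * exp (- c * \<bar>t\<bar>))
        \<le> norm (fact j * (1 / (c/2)) ^ j * exp (- (c/2) * \<bar>t\<bar>))"
    proof (rule AE_I2)
      fix t :: real
      have "\<bar>t\<bar> ^ j * exp (- c * \<bar>t\<bar>) \<le> fact j * (1 / (c/2)) ^ j * exp (c/2 * \<bar>t\<bar>) * exp (- c * \<bar>t\<bar>)"
        using power_le_exp[of "c/2" "\<bar>t\<bar>" j] assms by (intro mult_right_mono) auto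
      also have "\<dots> = fact j * (1 / (c/2)) ^ j * exp (- (c/2) * \<bar>t\<bar>)"
        by (simp only: mult.assoc flip: exp_add) (simp add: algebra_simps)
      finally show "norm (\<bar>t\<bar> ^ j * exp (- c * \<bar>t\<bar>))
        \<le> norm (fact j * (1 / (c/2)) ^ j * exp (- (c/2) * \<bar>t\<bar>))"
        using assms by (simp add: abs_mult)
    qed
  qed simp
  have "integrable lborel (\<lambda>t. \<Sum>i\<le>degree p. coeff p i * (\<bar>t\<bar> ^ i * exp (- c * \<bar>t\<bar>)))"
    by (intro Bochner_Integration.integrable_sum integrable_mult_right mono)
  then show ?thesis
    by (simp add: poly_altdef sum_distrib_right mult.assoc)
qed

section \<open>Even and odd integrals, and the moments of the quartic weight\<close>

lemma integral_even_lborel: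
  fixes f :: "real \<Rightarrow> real"
  assumes "set_integrable lborel {0<..} f" "\<And>t. f (- t) = f t"
  shows "(\<integral>t. f t \<partial>lborel) = 2 * (LBINT t:{0<..}. f t)"
proof -
  let ?h = "\<lambda>t. indicator {0<..} t * f t"
  have h: "integrable lborel ?h" using assms(1) by (simp add: set_integrable_def)
  have h': "integrable lborel (\<lambda>t. ?h (- t))"
    using lborel_integrable_real_affine[OF h, of "-1" 0] by simp
  have ae: "AE t in lborel. ?h t + ?h (- t) = f t"
    using AE_lborel_singleton[of 0] by eventually_elim (auto simp: indicator_def assms(2))
  have m: "(\<lambda>t. ?h t + ?h (- t)) \<in> borel_measurable lborel"
    using h h' by (intro borel_measurable_integrable Bochner_Integration.integrable_add)
  \<comment> \<open>Measurability of f is known only on the half-line; evenness extends it to t < 0,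
    and the value at 0 is patched in.\<close>
  have "(\<lambda>t. if t = 0 then f 0 else ?h t + ?h (- t)) \<in> borel_measurable lborel"
    using m by (intro measurable_If) auto
  also have "(\<lambda>t. if t = 0 then f 0 else ?h t + ?h (- t)) = f"
    by (auto simp: fun_eq_iff indicator_def assms(2))
  finally have "(\<integral>t. f t \<partial>lborel) = (\<integral>t. ?h t + ?h (- t) \<partial>lborel)"
    using m ae by (intro integral_cong_AE) auto
  also have "\<dots> = (\<integral>t. ?h t \<partial>lborel) + (\<integral>t. ?h (- t) \<partial>lborel)"
    by (rule Bochner_Integration.integral_add[OF h h'])
  also have "(\<integral>t. ?h (- t) \<partial>lborel) = (\<integral>t. ?h t \<partial>lborel)"
    using lborel_integral_real_affine[of "-1" ?h 0] by simp
  finally show ?thesis by (simp add: set_lebesgue_integral_def)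
qed

lemma integral_odd_lborel:
  fixes f :: "real \<Rightarrow> real"
  assumes "\<And>t. f (- t) = - f t"
  shows "(\<integral>t. f t \<partial>lborel) = 0"
  \<comment> \<open>Reflection makes the integral its own negative; without integrability both sides
    of the substitution are the default value 0.\<close>
  using lborel_integral_real_affine[of "-1" f 0] by (simp add: assms)

text \<open>Substituting u = k t^4 on the positive half-line gives Euler's integral for Gamma;
  evenness of n then doubles it.\<close>

lemma quartic_gaussian_moment:
  fixes k :: real
  assumes k: "k > 0" and n: "even n"
  shows "(\<integral>t. t ^ n * exp (- k * t^4) \<partial>lborel)
           = k powr (- (real n + 1) / 4) * Gamma ((real n + 1) / 4) / 2"
proof -
  \<comment> \<open>The Jacobian contributes t^3, so t^3 * (t^4)^(x - 1) = t^n forces this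
    x.\<close>
  define x where "x = (real n + 1) / 4"
  have x: "x > 0" by (simp add: x_def)
  let ?f = "\<lambda>u. u powr (x - 1) / exp u :: real"
  let ?g = "\<lambda>t. k * t^4 :: real"
  have img: "?g ` {0<..} = {0<..}"
  proof (intro equalityI subsetI)
    fix u :: real assume "u \<in> {0<..}"
    then have u: "u > 0" by simp
    have "u = ?g (root 4 (u / k))" using u k by simp
    moreover have "root 4 (u / k) \<in> {0<..}" using u k by simp
    ultimately show "u \<in> ?g ` {0<..}" by (rule image_eqI)
  qed (use k in auto)
  have inj: "inj_on ?g {0<..}"
    using k by (intro inj_onI) (auto intro: power_eq_imp_eq_base)
  \<comment> \<open>The Gamma integral lives on the closed half-line, whereas the substitution is a
    bijection of the open one; the endpoint is negligible.\<close>
  have fint: "(?f has_integral Gamma x) {0<..}"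
  proof (rule has_integral_spike_set_eq[THEN iffD1, OF _ _ Gamma_integral_real[OF x]])
    show "negligible {u \<in> {0..} - {0<..}. ?f u \<noteq> 0}"
      by (rule negligible_subset[of "{0}"]) auto
    show "negligible {u \<in> {0<..} - {0..}. ?f u \<noteq> 0}"
      by (rule negligible_subset[of "{}"]) auto
  qed
  then have "?f absolutely_integrable_on {0<..}"
    by (intro nonnegative_absolutely_integrable_1) (auto simp: integrable_on_def)
  then have cov: "(\<lambda>t. \<bar>4 * k * t^3\<bar> * ?f (?g t)) absolutely_integrable_on {0<..} \<and>
      integral {0<..} (\<lambda>t. \<bar>4 * k * t^3\<bar> * ?f (?g t)) = Gamma x"
    using fint
    by (subst has_absolute_integral_change_of_variables_1'[OF _ _ inj])
       (auto simp: img integral_unique intro!: derivative_eq_intros)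
  have eq: "\<bar>4 * k * t^3\<bar> * ?f (?g t) = 4 * k powr x * (t ^ n * exp (- k * t^4))"
    if "t \<in> {0<..}" for t
  proof -
    have t: "t > 0" using that by simp
    have "t^3 * (k * t^4) powr (x - 1) = k powr (x - 1) * (t powr 3 * (t powr 4) powr (x - 1))"
      using t k by (simp add: powr_mult)
    also have "t powr 3 * (t powr 4) powr (x - 1) = t powr (3 + 4 * (x - 1))"
      by (simp only: powr_powr powr_add)
    also have "3 + 4 * (x - 1) = real n" by (simp add: x_def field_simps)
    also have "t powr real n = t ^ n" using t by (rule powr_realpow)
    finally have "k * (t^3 * (k * t^4) powr (x - 1)) = k powr 1 * k powr (x - 1) * t ^ n"
      using k by simp
    also have "k powr 1 * k powr (x - 1) = k powr x" by (simp only: powr_add[symmetric]) simp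
    finally have "4 * k * t^3 * (k * t^4) powr (x - 1) = 4 * k powr x * t ^ n" by simp
    then show ?thesis using t k by (simp add: exp_minus field_simps)
  qed
  have I: "integral {0<..} (\<lambda>t. 4 * k powr x * (t ^ n * exp (- k * t^4))) = Gamma x"
    using conjunct2[OF cov] integral_cong[OF eq] by (rule trans[OF sym, rotated])
  have "(\<lambda>t. 4 * k powr x * (t ^ n * exp (- k * t^4))) absolutely_integrable_on {0<..}"
    using conjunct1[OF cov] set_integrable_cong[OF refl refl eq] by (rule iffD1[rotated])
  then have S4: "set_integrable lborel {0<..} (\<lambda>t. 4 * k powr x * (t ^ n * exp (- k * t^4)))"
    by (simp add: set_integrable_def integrable_completion)
  have kx: "k powr x > 0" using k by simp
  have S: "set_integrable lborel {0<..} (\<lambda>t. t ^ n * exp (- k * t^4))"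
    using S4 kx k by simp
  have "(LBINT t:{0<..}. 4 * k powr x * (t ^ n * exp (- k * t^4))) = Gamma x"
    using set_borel_integral_eq_integral(2)[OF S4] I by (rule trans)
  then have "4 * k powr x * (LBINT t:{0<..}. t ^ n * exp (- k * t^4)) = Gamma x"
    by simp
  moreover have "(\<integral>t. t ^ n * exp (- k * t^4) \<partial>lborel) = 2 * (LBINT t:{0<..}. t ^ n * exp (- k * t^4))"
    using S n by (intro integral_even_lborel) auto
  ultimately have "(\<integral>t. t ^ n * exp (- k * t^4) \<partial>lborel) = Gamma x / k powr x / 2"
    using kx k by (simp add: field_simps)
  also have "\<dots> = k powr (- x) * Gamma x / 2" by (simp add: powr_minus field_simps)
  also have "- x = - (real n + 1) / 4" by (simp add: x_def field_simps)
  finally show ?thesis by (simp add: x_def)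
qed

section \<open>Differentiation under the integral sign\<close>

text \<open>A quadratic remainder on a fixed neighbourhood yields the derivative, so no limit has to
  be exchanged with an integral.\<close>

lemma DERIV_of_quadratic_bound:
  fixes f :: "real \<Rightarrow> real"
  assumes r: "r > 0"
    and b: "\<And>s. \<bar>s - x\<bar> \<le> r \<Longrightarrow> \<bar>f s - f x - (s - x) * D\<bar> \<le> C * (s - x)\<^sup>2"
  shows "(f has_real_derivative D) (at x)"
proof -
  have "((\<lambda>h. (f (x + h) - f x) / h - D) \<longlongrightarrow> 0) (at 0)"
  proof (rule Lim_null_comparison)
    show "((\<lambda>h. C * \<bar>h\<bar>) \<longlongrightarrow> 0) (at 0)"
      by (auto intro!: tendsto_eq_intros)
    have "eventually (\<lambda>h::real. dist h 0 < r) (at 0)" 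
      unfolding eventually_at using r by (intro exI[of _ r]) auto
    moreover have "eventually (\<lambda>h::real. h \<noteq> 0) (at 0)"
      by (rule eventually_neq_at_within)
    ultimately show "\<forall>\<^sub>F h in at 0. norm ((f (x + h) - f x) / h - D) \<le> C * \<bar>h\<bar>"
    proof eventually_elim
      case (elim h)
      have "\<bar>f (x + h) - f x - h * D\<bar> \<le> C * h\<^sup>2"
        using b[of "x + h"] elim by (simp add: dist_real_def)
      then have "\<bar>f (x + h) - f x - h * D\<bar> / \<bar>h\<bar> \<le> C * h\<^sup>2 / \<bar>h\<bar>"
        by (intro divide_right_mono) auto
      moreover have "\<bar>f (x + h) - f x - h * D\<bar> / \<bar>h\<bar> = \<bar>(f (x + h) - f x) / h - D\<bar>"
        using elim(2) by (simp add: field_simps flip: abs_divide)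
      moreover have "h\<^sup>2 / \<bar>h\<bar> = \<bar>h\<bar>" using elim(2) by (simp add: power2_eq_square abs_if)
      ultimately show ?case by (simp flip: times_divide_eq_right)
    qed
  qed
  then show ?thesis by (simp add: DERIV_def LIM_zero_iff)
qed

text \<open>The remainder of the integrand is of second order in s - 1 and dominated by one fixed
  integrable function. For s >= 1/2 the perturbation costs exp (J/2) and the square of J costs exp
  (J/4), which leaves exp (- J/4) out of exp (- J): hence integrability at a quarter of the rate.
  Nonnegativity of J is asked only where w is nonzero, so that w may carry the indicator of the
  domain.\<close>

lemma laplace_integral_has_derivative:
  fixes w J :: "'a \<Rightarrow> real"
  assumes [measurable]: "w \<in> borel_measurable M" "J \<in> borel_measurable M"
    and J: "\<And>x. w x \<noteq> 0 \<Longrightarrow> J x \<ge> 0"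
    and int: "integrable M (\<lambda>x. w x * exp (- J x / 4))"
  shows "integrable M (\<lambda>x. w x * J x * exp (- J x))"
    and "((\<lambda>s. \<integral>x. w x * exp (- s * J x) \<partial>M) has_real_derivative
            - (\<integral>x. w x * J x * exp (- J x) \<partial>M)) (at 1)"
proof -
  let ?B = "\<lambda>x. w x * exp (- J x / 4)"
  have wexp: "integrable M (\<lambda>x. w x * exp (- s * J x))" if "s \<ge> 1/4" for s
  proof (rule Bochner_Integration.integrable_bound[OF int])
    show "AE x in M. norm (w x * exp (- s * J x)) \<le> norm (?B x)"
    proof (rule AE_I2)
      fix x
      show "norm (w x * exp (- s * J x)) \<le> norm (?B x)"
        using J[of x] mult_right_mono[OF that, of "J x"]
        by (cases "w x = 0") (auto simp: abs_mult)
    qed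
  qed simp
  show wJ: "integrable M (\<lambda>x. w x * J x * exp (- J x))"
  proof (rule Bochner_Integration.integrable_bound)
    show "integrable M (\<lambda>x. 2 * ?B x)" using int by simp
    show "AE x in M. norm (w x * J x * exp (- J x)) \<le> norm (2 * ?B x)"
    proof (rule AE_I2)
      fix x
      show "norm (w x * J x * exp (- J x)) \<le> norm (2 * ?B x)"
      proof (cases "w x = 0")
        case False
        then have Jx: "J x \<ge> 0" by (rule J)
        have "J x * exp (- J x) \<le> 2 * exp (J x / 2) * exp (- J x)"
          using power_le_exp[of "1/2" "J x" 1] Jx by (intro mult_right_mono) auto
        also have "\<dots> = 2 * exp (- J x / 2)" by (simp add: field_simps flip: exp_add)
        also have "\<dots> \<le> 2 * exp (- J x / 4)" using Jx by simp
        finally have "\<bar>w x\<bar> * (J x * exp (- J x)) \<le> \<bar>w x\<bar> * (2 * exp (- J x / 4))"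
          by (rule mult_left_mono) simp
        then show ?thesis using Jx by (simp add: abs_mult mult_ac)
      qed simp
    qed
  qed simp
  show "((\<lambda>s. \<integral>x. w x * exp (- s * J x) \<partial>M) has_real_derivative
            - (\<integral>x. w x * J x * exp (- J x) \<partial>M)) (at 1)"
  proof (rule DERIV_of_quadratic_bound[of "1/2" _ _ _ "\<integral>x. 16 * \<bar>?B x\<bar> \<partial>M"])
    fix s :: real assume s: "\<bar>s - 1\<bar> \<le> 1/2"
    have s': "s \<ge> 1/2" using s by linarith
    let ?R = "\<lambda>x. w x * exp (- s * J x) - w x * exp (- 1 * J x) + (s - 1) * (w x * J x * exp (- J x))"
    have i1: "integrable M (\<lambda>x. w x * exp (- s * J x))" using s' by (intro wexp) simp
    have i2: "integrable M (\<lambda>x. w x * exp (- 1 * J x))" by (intro wexp) simp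
    have iR: "integrable M ?R"
      using i1 i2 wJ by (intro Bochner_Integration.integrable_add Bochner_Integration.integrable_diff integrable_mult_right)
    have "(\<integral>x. w x * exp (- s * J x) \<partial>M) - (\<integral>x. w x * exp (- 1 * J x) \<partial>M)
        - (s - 1) * - (\<integral>x. w x * J x * exp (- J x) \<partial>M) = (\<integral>x. ?R x \<partial>M)"
      using i1 i2 wJ by (subst Bochner_Integration.integral_add) auto
    moreover have "\<bar>\<integral>x. ?R x \<partial>M\<bar> \<le> (\<integral>x. (16 * \<bar>?B x\<bar>) * (s - 1)\<^sup>2 \<partial>M)"
    proof (rule order_trans[OF integral_abs_bound integral_mono])
      show "integrable M (\<lambda>x. \<bar>?R x\<bar>)" using iR by (rule integrable_abs)
      show "integrable M (\<lambda>x. (16 * \<bar>?B x\<bar>) * (s - 1)\<^sup>2)" using int by simp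
      fix x
      show "\<bar>?R x\<bar> \<le> (16 * \<bar>?B x\<bar>) * (s - 1)\<^sup>2"
      proof (cases "w x = 0")
        case False
        then have Jx: "J x \<ge> 0" by (rule J)
        \<comment> \<open>The perturbing exponent when exp (- s J) is written as exp (- J) * exp
          y.\<close>
        define y where "y = (1 - s) * J x"
        have y2: "y\<^sup>2 \<le> (s - 1)\<^sup>2 * (32 * exp (J x / 4))"
        proof -
          have "(J x)\<^sup>2 \<le> 32 * exp (J x / 4)"
            using power_le_exp[of "1/4" "J x" 2] Jx by simp
          then show ?thesis
            by (auto simp: y_def power_mult_distrib power2_commute[of 1 s] intro!: mult_left_mono)
        qed
        have "y \<le> J x / 2" using s' Jx mult_right_mono[of "1 - s" "1/2" "J x"] by (simp add: y_def)
        then have m: "max 1 (exp y) \<le> exp (J x / 2)" using Jx by simp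
        have "?R x = w x * exp (- J x) * (exp y - 1 - y)"
          by (simp add: y_def algebra_simps flip: exp_add)
        then have "\<bar>?R x\<bar> = \<bar>w x\<bar> * exp (- J x) * \<bar>exp y - 1 - y\<bar>"
          by (simp add: abs_mult)
        also have "\<dots> \<le> \<bar>w x\<bar> * exp (- J x) * ((s - 1)\<^sup>2 * (32 * exp (J x / 4)) / 2 * exp (J x / 2))"
          using y2 m
          by (intro mult_left_mono order_trans[OF exp_minus_linear_le] mult_mono divide_right_mono) auto
        also have "\<dots> = 16 * \<bar>w x\<bar> * (s - 1)\<^sup>2 * (exp (- J x) * exp (J x / 4) * exp (J x / 2))"
          by simp
        also have "exp (- J x) * exp (J x / 4) * exp (J x / 2) = exp (- J x / 4)"
          by (simp flip: exp_add)
        finally show ?thesis by (simp add: abs_mult mult_ac)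
      qed simp
    qed
    ultimately show "\<bar>(\<integral>x. w x * exp (- s * J x) \<partial>M) - (\<integral>x. w x * exp (- 1 * J x) \<partial>M)
        - (s - 1) * - (\<integral>x. w x * J x * exp (- J x) \<partial>M)\<bar> \<le> (\<integral>x. 16 * \<bar>?B x\<bar> \<partial>M) * (s - 1)\<^sup>2"
      by simp
  qed simp
qed

section \<open>Laplace asymptotics at a quartic minimum\<close>

lemma integral_error_bound:
  fixes h :: "real \<Rightarrow> real"
  assumes "h \<in> borel_measurable lborel" "integrable lborel m" "integrable lborel M"
    and b: "\<And>t. \<bar>h t - m t\<bar> \<le> e * M t"
  shows "integrable lborel h" 
    and "\<bar>(\<integral>t. h t \<partial>lborel) - (\<integral>t. m t \<partial>lborel)\<bar> \<le> e * (\<integral>t. M t \<partial>lborel)"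
proof -
  have eM: "integrable lborel (\<lambda>t. e * M t)" using assms(3) by simp
  have d: "integrable lborel (\<lambda>t. h t - m t)"
  proof (rule Bochner_Integration.integrable_bound[OF eM])
    show "(\<lambda>t. h t - m t) \<in> borel_measurable lborel" using assms by simp
    show "AE t in lborel. norm (h t - m t) \<le> norm (e * M t)"
      using b by (intro AE_I2) (metis abs_ge_self order_trans real_norm_def)
  qed
  have "integrable lborel (\<lambda>t. (h t - m t) + m t)"
    using d assms(2) by (rule Bochner_Integration.integrable_add)
  then show h: "integrable lborel h" by simp
  have "\<bar>\<integral>t. h t - m t \<partial>lborel\<bar> \<le> (\<integral>t. e * M t \<partial>lborel)"
    using d eM b by (rule integral_abs_bound_integral)
  then show "\<bar>(\<integral>t. h t \<partial>lborel) - (\<integral>t. m t \<partial>lborel)\<bar> \<le> e * (\<integral>t. M t \<partial>lborel)"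
    using h assms(2) by simp
qed

text \<open>With -w/(1+x) = -w + y and y = w x/(1+x), two second-order errors arise: the Taylor
  remainder of exp y, and y - w x = -w x^2/(1+x). The number \<mu> keeps 1 + x away from 0. The
  common bound E is used because exp y exceeds 1 for x > 0, and the perturbed exponential is then
  the slower decay.\<close>

lemma exp_quartic_expansion:
  fixes x w \<mu> E :: real
  assumes \<mu>: "0 < \<mu>" "\<mu> \<le> 1 + x" and w: "w \<ge> 0" 
    and E: "exp (- w) \<le> E" "exp (- w / (1 + x)) \<le> E"
  shows "\<bar>exp (- w / (1 + x)) - exp (- w) * (1 + w * x)\<bar> \<le> (w / \<mu> + w\<^sup>2 / (2 * \<mu>\<^sup>2)) * x\<^sup>2 * E"
proof -
  define y where "y = w * x / (1 + x)"
  have x1: "1 + x > 0" using \<mu> by linarith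
  have e: "exp (- w / (1 + x)) = exp (- w) * exp y"
    using x1 by (simp add: y_def field_simps flip: exp_add)
  have "exp (- w / (1 + x)) - exp (- w) * (1 + w * x) = exp (- w) * ((exp y - 1 - y) + (y - w * x))"
    unfolding e by (simp add: algebra_simps)
  then have "\<bar>exp (- w / (1 + x)) - exp (- w) * (1 + w * x)\<bar>
      = exp (- w) * \<bar>(exp y - 1 - y) + (y - w * x)\<bar>"
    by (simp add: abs_mult)
  also have "\<dots> \<le> exp (- w) * (\<bar>exp y - 1 - y\<bar> + \<bar>y - w * x\<bar>)"
    by (intro mult_left_mono abs_triangle_ineq) simp
  also have "\<dots> = exp (- w) * \<bar>exp y - 1 - y\<bar> + exp (- w) * \<bar>y - w * x\<bar>"
    by (simp add: algebra_simps)
  also have "exp (- w) * \<bar>exp y - 1 - y\<bar> \<le> exp (- w) * (y\<^sup>2 / 2 * max 1 (exp y))"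
    by (intro mult_left_mono exp_minus_linear_le) simp
  also have "\<dots> = y\<^sup>2 / 2 * max (exp (- w)) (exp (- w / (1 + x)))"
    unfolding e by (auto simp: max_def)
  also have "\<dots> \<le> y\<^sup>2 / 2 * E" using E by (intro mult_left_mono) auto
  also have "y\<^sup>2 / 2 * E \<le> (w\<^sup>2 / (2 * \<mu>\<^sup>2) * x\<^sup>2) * E"
  proof (rule mult_right_mono)
    have "(w * x)\<^sup>2 / (1 + x)\<^sup>2 \<le> (w * x)\<^sup>2 / \<mu>\<^sup>2"
      using \<mu> x1 by (intro divide_left_mono power_mono mult_pos_pos) auto
    then show "y\<^sup>2 / 2 \<le> w\<^sup>2 / (2 * \<mu>\<^sup>2) * x\<^sup>2"
      by (simp add: y_def power_divide power_mult_distrib)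
    show "0 \<le> E" using E(1) exp_ge_zero order_trans by blast
  qed
  also have "exp (- w) * \<bar>y - w * x\<bar> \<le> E * (w / \<mu> * x\<^sup>2)"
  proof (rule mult_mono)
    have "y - w * x = - (w * x\<^sup>2 / (1 + x))"
      using x1 by (simp add: y_def field_simps power2_eq_square)
    then have "\<bar>y - w * x\<bar> = w * x\<^sup>2 / (1 + x)" using w x1 by simp
    also have "\<dots> \<le> w * x\<^sup>2 / \<mu>" using w \<mu> x1 by (intro divide_left_mono mult_pos_pos) auto
    finally show "\<bar>y - w * x\<bar> \<le> w / \<mu> * x\<^sup>2" by simp
    show "0 \<le> E" using E(1) exp_ge_zero order_trans by blast
  qed (use E in auto)
  finally show ?thesis by (simp add: algebra_simps)
qed

text \<open>The denominator grows at most linearly, so the exponent still grows at least cubically;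
  only a linear rate is kept. For |t| >= 1 one has 1 + |t|/a <= (1 + 1/a) |t|, which explains c, and
  the factor exp c takes care of |t| <= 1. The case e = 0 gives the unperturbed weight the same
  bound.\<close>

lemma exp_quartic_decay:
  fixes k a e t :: real
  assumes "k > 0" "a > 0" "0 \<le> e" "e \<le> 1" "1 + e * t / a > 0"
  defines "c \<equiv> k / (1 + 1 / a)"
  shows "exp (- (k * t^4) / (1 + e * t / a)) \<le> exp c * exp (- c * \<bar>t\<bar>)"
proof -
  define y where "y = \<bar>t\<bar>"
  have y: "y \<ge> 0" by (simp add: y_def)
  have t4: "t^4 = y^4" by (simp add: y_def)
  have cy: "c * (y - 1) * (1 + y / a) \<le> k * y^4"
  proof (cases "y \<le> 1")
    case True
    have "c * (y - 1) * (1 + y / a) \<le> 0"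
      using True assms y by (intro mult_nonpos_nonneg mult_nonneg_nonpos) (auto simp: c_def)
    also have "0 \<le> k * y^4" using assms by simp
    finally show ?thesis .
  next
    case False
    have "c * (y - 1) * (1 + y / a) \<le> c * (y - 1) * (y * (1 + 1 / a))"
      using False assms by (intro mult_left_mono) (auto simp: c_def field_simps)
    also have "\<dots> = k * (y - 1) * y"
      using assms by (simp add: c_def) (simp add: field_simps add_pos_pos)
    also have "\<dots> \<le> k * (y * y * y) * y"
    proof -
      have "y - 1 \<le> 1 * 1 * y" by simp
      also have "\<dots> \<le> y * y * y" using False by (intro mult_mono) auto
      finally show ?thesis using assms y by (intro mult_right_mono mult_left_mono) auto
    qed
    also have "\<dots> = k * y^4" by (simp add: power4_eq_xxxx)
    finally show ?thesis .
  qed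
  have "e * t \<le> e * y" using assms(3) by (intro mult_left_mono) (auto simp: y_def)
  also have "\<dots> \<le> 1 * y" using assms(4) y by (intro mult_right_mono) auto
  finally have et: "1 + e * t / a \<le> 1 + y / a" using assms(2) by (simp add: divide_right_mono)
  have "c * (y - 1) \<le> k * y^4 / (1 + y / a)"
    using cy y assms(2) by (simp add: pos_le_divide_eq add_pos_nonneg)
  also have "\<dots> \<le> k * y^4 / (1 + e * t / a)"
    using et assms y by (intro divide_left_mono) (auto intro!: mult_pos_pos add_pos_nonneg)
  finally have "- (k * t^4) / (1 + e * t / a) \<le> c + (- c * \<bar>t\<bar>)"
    unfolding t4 by (simp add: y_def algebra_simps)
  then show ?thesis by (simp flip: exp_add)
qed

text \<open>
  The integrand is the rescaling \<open>\<delta> = e t\<close> of \<open>f \<delta>\<close> against the phase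
  \<open>k \<delta>\<^sup>4 / (1 + \<delta> / a)\<close> with large parameter \<open>1 / e\<^sup>4\<close>.
\<close>

lemma quartic_laplace:
  fixes f :: "real \<Rightarrow> real" and k a d K f0 f1 :: real and n :: nat
  assumes k: "k > 0" and d: "0 < d" "d < a" and n: "even n"
    and [measurable]: "f \<in> borel_measurable borel"
    and f: "\<And>\<delta>. - d < \<delta> \<Longrightarrow> \<bar>f \<delta> - f0 - f1 * \<delta>\<bar> \<le> K * \<delta>\<^sup>2"
  defines "H \<equiv> \<lambda>e t. indicator {- d<..} (e * t) * (t ^ n * f (e * t) * exp (- (k * t^4) / (1 + e * t / a)))"
  shows "\<exists>C. \<forall>e. 0 < e \<and> e \<le> 1 \<longrightarrow> integrable lborel (H e) \<and>
    \<bar>(\<integral>t. H e t \<partial>lborel) - f0 * (\<integral>t. t ^ n * exp (- k * t^4) \<partial>lborel)\<bar> \<le> C * e\<^sup>2"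
proof -
  \<comment> \<open>Lower bound for 1 + \<delta>/a on \<delta> > -d, positive since d < a.\<close>
  define \<mu> where "\<mu> = (a - d) / a"
  have \<mu>: "\<mu> > 0" and a: "a > 0" using d by (auto simp: \<mu>_def)
  define c where "c = k / (1 + 1 / a)"
  have c: "c > 0" using k a by (simp add: c_def add_pos_pos)
  define D where "D t = exp c * exp (- c * \<bar>t\<bar>)" for t
  define W where "W = monom k 4"
  \<comment> \<open>A majorant in |t| for the coefficient of e^2. In order: the remainder of f, the
    remainder of the exponential, the product of the two linear corrections, and the first-order
    model on the cut-off region. A polynomial is integrable against D at once.\<close>
  define S where "S = monom 1 n * monom 1 2 *
    ([:K:] + smult (1 / a\<^sup>2) ([:\<bar>f0\<bar>, \<bar>f1\<bar>:] * (smult (1 / \<mu>) W + smult (1 / (2 * \<mu>\<^sup>2)) (W\<^sup>2)))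
      + smult (\<bar>f1\<bar> / a) W
      + smult (1 / d\<^sup>2) ([:\<bar>f0\<bar>, \<bar>f1\<bar>:] + smult (\<bar>f0\<bar> / a) ([:0, 1:] * W)))"
  define M where "M t = poly S \<bar>t\<bar> * D t" for t
  have intM: "integrable lborel M"
  proof -
    have "integrable lborel (\<lambda>t. exp c * (poly S \<bar>t\<bar> * exp (- c * \<bar>t\<bar>)))"
      using c by (intro integrable_mult_right integrable_poly_exp_minus_abs)
    then show ?thesis by (simp add: M_def[abs_def] D_def mult_ac)
  qed
  have K: "K \<ge> 0" using f[of d] d by (smt (verit) zero_le_mult_iff zero_less_power)
  have Dw: "exp (- (k * t^4)) \<le> D t" for t
    using exp_quartic_decay[of k a 0 t] k a by (simp add: D_def c_def)
  \<comment> \<open>The first-order model carries no cut-off: only on the whole line does its part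
    linear in e integrate to zero by symmetry.\<close>
  define m where "m e t = exp (- (k * t^4)) * (f0 + f1 * (e * t) + f0 * (k * t^4) * (e * t / a)) * t ^ n" for e t
  have bound: "\<bar>H e t - m e t\<bar> \<le> e\<^sup>2 * M t" if e: "0 < e" "e \<le> 1" for e t
  proof -
    define y where "y = \<bar>t\<bar>"
    define w where "w = k * t^4"
    define x where "x = e * t / a"
    have y: "y \<ge> 0" and w: "w \<ge> 0" using k by (auto simp: y_def w_def)
    have wy: "w = k * y^4" by (simp add: w_def y_def)
    have D0: "D t \<ge> 0" by (simp add: D_def)
    have S: "poly S \<bar>t\<bar> = y ^ n * y\<^sup>2 * (K + (\<bar>f0\<bar> + \<bar>f1\<bar> * y) * (w / \<mu> + w\<^sup>2 / (2 * \<mu>\<^sup>2)) / a\<^sup>2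
        + \<bar>f1\<bar> * w / a + (\<bar>f0\<bar> + \<bar>f1\<bar> * y + \<bar>f0\<bar> * w * y / a) / d\<^sup>2)"
    proof -
      have W: "poly W y = w" by (simp add: W_def wy poly_monom)
      show ?thesis unfolding S_def y_def[symmetric]
        by (simp add: W poly_monom) (simp add: algebra_simps add_divide_distrib)
    qed
    have Q1: "0 \<le> (\<bar>f0\<bar> + \<bar>f1\<bar> * y) * (w / \<mu> + w\<^sup>2 / (2 * \<mu>\<^sup>2)) / a\<^sup>2 + \<bar>f1\<bar> * w / a"
      using y w a \<mu> by (intro add_nonneg_nonneg mult_nonneg_nonneg divide_nonneg_nonneg) auto
    have Q2: "0 \<le> (\<bar>f0\<bar> + \<bar>f1\<bar> * y + \<bar>f0\<bar> * w * y / a) / d\<^sup>2"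
      using y w a by (intro add_nonneg_nonneg mult_nonneg_nonneg divide_nonneg_nonneg) auto
    have ey: "\<bar>e * t\<bar> \<le> y" "\<bar>e * t\<bar> = e * y"
      using e mult_right_mono[of e 1 y] y by (simp_all add: y_def abs_mult)
    have tn: "\<bar>t ^ n\<bar> = y ^ n" by (simp add: y_def power_abs)
    show ?thesis
    proof (cases "e * t > - d")
      case True
      have x: "\<mu> \<le> 1 + x" using divide_right_mono[of "- d" "e * t" a] True a by (simp add: \<mu>_def x_def diff_divide_distrib)
      have x1: "1 + x > 0" using x \<mu> by linarith
      define E where "E = exp (- w / (1 + x))"
      have ED: "E \<le> D t" using exp_quartic_decay[of k a e t] k a e x1
        by (simp add: D_def c_def E_def w_def x_def)
      have E0: "E \<ge> 0" by (simp add: E_def)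
      define r where "r = f (e * t) - f0 - f1 * (e * t)"
      have r: "\<bar>r\<bar> \<le> K * (e * y)\<^sup>2" using f[OF True] by (simp add: r_def y_def power_mult_distrib)
      \<comment> \<open>Separates three errors: f against its linear part, the exponential against
        its linear part, and the product of the two linear terms, which is already of order
        e^2.\<close>
      have "H e t - m e t = t ^ n * (r * E + (f0 + f1 * (e * t)) * (E - exp (- w) * (1 + w * x))
          + exp (- w) * (f1 * (e * t) * w * x))"
      proof -
        have "H e t = t ^ n * f (e * t) * E"
          using True by (simp add: H_def E_def w_def x_def)
        moreover have "m e t = exp (- w) * (f0 + f1 * (e * t) + f0 * w * x) * t ^ n"
          by (simp add: m_def w_def x_def)
        ultimately show ?thesis by (simp add: r_def algebra_simps)
      qed
      then have "\<bar>H e t - m e t\<bar> = y ^ n * \<bar>r * E + (f0 + f1 * (e * t)) * (E - exp (- w) * (1 + w * x))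
          + exp (- w) * (f1 * (e * t) * w * x)\<bar>"
        by (simp add: abs_mult tn)
      also have "\<dots> \<le> y ^ n * (K * (e * y)\<^sup>2 * D t
          + (\<bar>f0\<bar> + \<bar>f1\<bar> * y) * ((w / \<mu> + w\<^sup>2 / (2 * \<mu>\<^sup>2)) * (e * y / a)\<^sup>2 * D t)
          + D t * (\<bar>f1\<bar> * (e * y) * w * (e * y / a)))"
      proof (intro mult_left_mono order_trans[OF abs_triangle_ineq] add_mono)
        show "\<bar>r * E\<bar> \<le> K * (e * y)\<^sup>2 * D t"
          unfolding abs_mult using r ED E0 by (intro mult_mono) auto
        have "\<bar>f0 + f1 * (e * t)\<bar> \<le> \<bar>f0\<bar> + \<bar>f1\<bar> * y"
          using ey(1) by (intro order_trans[OF abs_triangle_ineq] add_mono) (auto simp: abs_mult mult_left_mono)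
        moreover have "\<bar>E - exp (- w) * (1 + w * x)\<bar> \<le> (w / \<mu> + w\<^sup>2 / (2 * \<mu>\<^sup>2)) * x\<^sup>2 * D t"
          unfolding E_def using \<mu> x w Dw[of t] ED
          by (intro exp_quartic_expansion) (auto simp: w_def E_def)
        moreover have "x\<^sup>2 = (e * y / a)\<^sup>2" by (simp add: x_def y_def power_mult_distrib power_divide)
        ultimately show "\<bar>(f0 + f1 * (e * t)) * (E - exp (- w) * (1 + w * x))\<bar>
            \<le> (\<bar>f0\<bar> + \<bar>f1\<bar> * y) * ((w / \<mu> + w\<^sup>2 / (2 * \<mu>\<^sup>2)) * (e * y / a)\<^sup>2 * D t)"
          unfolding abs_mult using y by (intro mult_mono) auto
        have "\<bar>f1 * (e * t) * w * x\<bar> = \<bar>f1\<bar> * (e * y) * w * (e * y / a)"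
          using ey(2) w a by (simp add: abs_mult x_def) 
        then show "\<bar>exp (- w) * (f1 * (e * t) * w * x)\<bar> \<le> D t * (\<bar>f1\<bar> * (e * y) * w * (e * y / a))"
          unfolding abs_mult[of "exp (- w)"] using Dw[of t] w y e a D0 by (intro mult_mono) (auto simp: w_def)
      qed (use y in auto)
      also have "\<dots> = e\<^sup>2 * (y ^ n * y\<^sup>2 * (K + (\<bar>f0\<bar> + \<bar>f1\<bar> * y) * (w / \<mu> + w\<^sup>2 / (2 * \<mu>\<^sup>2)) / a\<^sup>2
        + \<bar>f1\<bar> * w / a) * D t)"
        using a by (simp add: power_mult_distrib power_divide) (simp add: field_simps power2_eq_square)
      also have "\<dots> \<le> e\<^sup>2 * M t"
        unfolding M_def S using y D0 Q2
        by (intro mult_left_mono mult_right_mono) auto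
      finally show ?thesis .
    next
      case False
      \<comment> \<open>Here H vanishes and only the model remains; since e |t| >= d, the factor (e
        t / d)^2 >= 1 may be inserted to produce the required e^2.\<close>
      have "1 \<le> \<bar>e * t\<bar> / d" using False d by (simp add: field_simps)
      then have "1\<^sup>2 \<le> (\<bar>e * t\<bar> / d)\<^sup>2" by (intro power_mono) auto
      then have one: "1 \<le> e\<^sup>2 * y\<^sup>2 / d\<^sup>2" by (simp add: ey(2) power_divide power_mult_distrib)
      have "\<bar>H e t - m e t\<bar> = exp (- w) * \<bar>f0 + f1 * (e * t) + f0 * w * (e * t / a)\<bar> * y ^ n"
        using False by (simp add: H_def m_def abs_mult tn w_def)
      also have "\<dots> \<le> D t * (\<bar>f0\<bar> + \<bar>f1\<bar> * y + \<bar>f0\<bar> * w * (y / a)) * y ^ n"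
      proof (intro mult_right_mono mult_mono order_trans[OF abs_triangle_ineq] add_mono)
        show "\<bar>f1 * (e * t)\<bar> \<le> \<bar>f1\<bar> * y" unfolding abs_mult[of f1] using ey(1) by (intro mult_left_mono) auto
        have "\<bar>f0 * w * (e * t / a)\<bar> = \<bar>f0\<bar> * w * (\<bar>e * t\<bar> / a)" using w a by (simp add: abs_mult)
        also have "\<dots> \<le> \<bar>f0\<bar> * w * (y / a)" using ey(1) w a by (intro mult_left_mono divide_right_mono) auto
        finally show "\<bar>f0 * w * (e * t / a)\<bar> \<le> \<bar>f0\<bar> * w * (y / a)" .
        show "exp (- w) \<le> D t" using Dw[of t] by (simp add: w_def)
      qed (use y D0 in auto)
      also have "\<dots> = 1 * (y ^ n * ((\<bar>f0\<bar> + \<bar>f1\<bar> * y + \<bar>f0\<bar> * w * y / a)) * D t)"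
        by (simp add: mult_ac)
      also have "\<dots> \<le> (e\<^sup>2 * y\<^sup>2 / d\<^sup>2) * (y ^ n * ((\<bar>f0\<bar> + \<bar>f1\<bar> * y + \<bar>f0\<bar> * w * y / a)) * D t)"
        using one y D0 w a by (intro mult_right_mono) auto
      also have "\<dots> = e\<^sup>2 * (y ^ n * y\<^sup>2 * ((\<bar>f0\<bar> + \<bar>f1\<bar> * y + \<bar>f0\<bar> * w * y / a) / d\<^sup>2) * D t)"
        by (simp add: mult_ac)
      also have "\<dots> \<le> e\<^sup>2 * M t"
        unfolding M_def S using y D0 K Q1
        by (intro mult_left_mono mult_right_mono) auto
      finally show ?thesis .
    qed
  qed
  have pe: "integrable lborel (\<lambda>t. t ^ j * exp (- (k * t^4)))" for j
  proof (rule Bochner_Integration.integrable_bound)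
    show "integrable lborel (\<lambda>t. exp c * (poly (monom 1 j) \<bar>t\<bar> * exp (- c * \<bar>t\<bar>)))"
      using c by (intro integrable_mult_right integrable_poly_exp_minus_abs)
    show "AE t in lborel. norm (t ^ j * exp (- (k * t^4)))
        \<le> norm (exp c * (poly (monom 1 j) \<bar>t\<bar> * exp (- c * \<bar>t\<bar>)))"
    proof (rule AE_I2)
      fix t
      show "norm (t ^ j * exp (- (k * t^4))) \<le> norm (exp c * (poly (monom 1 j) \<bar>t\<bar> * exp (- c * \<bar>t\<bar>)))"
        using mult_left_mono[OF Dw[of t], of "\<bar>t\<bar> ^ j"]
        by (simp add: abs_mult D_def poly_monom power_abs mult_ac)
    qed
  qed simp
  \<comment> \<open>Since (k t^4) (e t / a) = e k t^5 / a, the part linear in e contains only the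
    powers n + 1 and n + 5, odd for even n.\<close>
  have m_eq: "m e = (\<lambda>t. f0 * (t ^ n * exp (- (k * t^4))) + e *
      (f1 * (t ^ (n + 1) * exp (- (k * t^4))) + f0 * k / a * (t ^ (n + 5) * exp (- (k * t^4)))))" for e
  proof -
    have "t ^ (n + 5) = t ^ n * t ^ 4 * t" "t ^ (n + 1) = t ^ n * t" for t :: real
      by (simp_all add: eval_nat_numeral)
    then show ?thesis unfolding m_def by (simp add: fun_eq_iff algebra_simps)
  qed
  have intm: "integrable lborel (m e)" for e
    unfolding m_eq by (intro Bochner_Integration.integrable_add integrable_mult_right pe)
  have odd: "(\<integral>t. t ^ j * exp (- (k * t^4)) \<partial>lborel) = 0" if "odd j" for j
    using that by (intro integral_odd_lborel) auto
  have "(\<integral>t. m e t \<partial>lborel) = f0 * (\<integral>t. t ^ n * exp (- k * t^4) \<partial>lborel)" for e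
  proof -
    have "(\<integral>t. m e t \<partial>lborel) = f0 * (\<integral>t. t ^ n * exp (- (k * t^4)) \<partial>lborel) + e *
      (f1 * (\<integral>t. t ^ (n + 1) * exp (- (k * t^4)) \<partial>lborel) + f0 * k / a * (\<integral>t. t ^ (n + 5) * exp (- (k * t^4)) \<partial>lborel))"
      unfolding m_eq
      by (subst Bochner_Integration.integral_add integral_mult_right_zero
          | intro Bochner_Integration.integrable_add integrable_mult_right pe refl)+
    then show ?thesis using odd[of "n + 1"] odd[of "n + 5"] n by simp
  qed
  moreover have "H e \<in> borel_measurable lborel" for e unfolding H_def by measurable
  ultimately have "integrable lborel (H e) \<and>
    \<bar>(\<integral>t. H e t \<partial>lborel) - f0 * (\<integral>t. t ^ n * exp (- k * t^4) \<partial>lborel)\<bar> \<le> (\<integral>t. M t \<partial>lborel) * e\<^sup>2"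
    if "0 < e" "e \<le> 1" for e
    using integral_error_bound[OF _ intm intM bound[OF that]] by (simp add: mult.commute)
  then show ?thesis by blast
qed

section \<open>The critical ensemble\<close>

lemma z_crit_pos: "z_crit > 0"
  and z_crit_square: "z_crit\<^sup>2 = 1 / 6"
  and sqrt_6_z_crit: "sqrt 6 = 1 / z_crit"
  by (simp_all add: z_crit_def power_divide)

lemma z_crit_powers:
  "z_crit ^ 3 = z_crit / 6" "z_crit ^ 4 = 1 / 36" "z_crit * z_crit = 1 / 6" "1 / z_crit = 6 * z_crit"
proof -
  show mult: "z_crit * z_crit = 1 / 6" using z_crit_square by (simp add: power2_eq_square)
  then show "z_crit ^ 3 = z_crit / 6" by (simp add: power3_eq_cube)
  show "1 / z_crit = 6 * z_crit" using mult z_crit_pos by (simp add: field_simps)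
  have "z_crit ^ 4 = (z_crit\<^sup>2)\<^sup>2" by simp
  also have "\<dots> = 1 / 36" by (simp only: z_crit_square) (simp add: power_divide)
  finally show "z_crit ^ 4 = 1 / 36" .
qed

text \<open>The last identity is the vanishing of the energy density at \<open>z_ext q_crit\<close>
  with denominators cleared; in this form the sign of the density becomes a comparison of
  squares.\<close>

lemma z_ext_crit:
  shows "z_ext q_crit > 0" "z_ext q_crit < z_crit"
    and "3 * (6 * (z_ext q_crit)\<^sup>2 + 1)\<^sup>2 = 4"
proof -
  \<comment> \<open>The inner root at q = 1/6, where 1 + 12 q^2 = 4/3. Its bounds 1 and 2 give
    positivity of \<open>z_ext q_crit\<close> and its position below \<open>z_crit\<close>.\<close>
  define s where "s = sqrt (4 / 3)"
  have s: "1 < s" "s < 2" by (auto simp: s_def real_less_rsqrt real_less_lsqrt)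
  have z: "z_ext q_crit = sqrt ((- 1 + s) / 6)"
    by (simp add: z_ext_def q_crit_def s_def power2_eq_square)
  show "z_ext q_crit > 0" using s by (simp add: z)
  have z_crit: "z_crit = sqrt (1 / 6)" by (simp add: z_crit_def real_sqrt_divide)
  show "z_ext q_crit < z_crit" unfolding z z_crit real_sqrt_less_iff using s by simp
  have "s\<^sup>2 = 4 / 3" by (simp add: s_def)
  moreover have "(z_ext q_crit)\<^sup>2 = (s - 1) / 6" using s by (simp add: z)
  then have "6 * (z_ext q_crit)\<^sup>2 + 1 = s" by (simp add: field_simps)
  ultimately show "3 * (6 * (z_ext q_crit)\<^sup>2 + 1)\<^sup>2 = 4" by simp
qed

lemma energy_density_pos:
  assumes "z > z_ext q_crit"
  shows "energy_density z q_crit > 0"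
proof -
  have z: "z > 0" using assms z_ext_crit(1) by linarith
  have "(z_ext q_crit)\<^sup>2 < z\<^sup>2"
    using assms z_ext_crit(1) by (intro power_strict_mono) auto
  then have "(6 * (z_ext q_crit)\<^sup>2 + 1)\<^sup>2 < (6 * z\<^sup>2 + 1)\<^sup>2"
    by (intro power_strict_mono) auto
  then have "3 * (6 * z\<^sup>2 + 1)\<^sup>2 - 4 > 0" using z_ext_crit(3) by linarith
  moreover have "energy_density z q_crit = (3 * (6 * z\<^sup>2 + 1)\<^sup>2 - 4) / (72 * z\<^sup>2)"
    using z by (simp add: energy_density_def q_crit_def field_simps power2_eq_square)
  ultimately show ?thesis using z by simp
qed

text \<open>Times z, the numerator of the action is z^4 - 4 a z^3 + z^2 + 1/36 with a =
  \<open>z_crit\<close>; because a^2 = 1/6 this is (z - a)^4 + (2/3) a z. The last term produces the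
  constant pi/6, so the formula is exact rather than local.\<close>

lemma reduced_action_crit:
  assumes "z \<noteq> 0"
  shows "reduced_action z \<tau>_crit q_crit = pi / 6 + 3 * pi / 2 * (z - z_crit)^4 / (z / z_crit)"
proof -
  have t: "2 * pi * \<tau>_crit = 4 * z_crit" "2 * \<tau>_crit = 4 * z_crit / pi"
    by (simp_all add: \<tau>_crit_def sqrt_6_z_crit z_crit_powers(4))
  have "(z - z_crit)^4 = z^4 - 4 * z_crit * z^3 + 6 * (z_crit * z_crit) * z^2 - 4 * z_crit^3 * z + z_crit^4"
    by (simp add: algebra_simps power4_eq_xxxx power3_eq_cube power2_eq_square)
  also have "\<dots> = z^4 - 4 * z_crit * z^3 + z^2 - 2 / 3 * z_crit * z + 1 / 36"
    unfolding z_crit_powers by simp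
  finally have 4: "(z - z_crit)^4 = z^4 - 4 * z_crit * z^3 + z^2 - 2 / 3 * z_crit * z + 1 / 36" .
  have "reduced_action z \<tau>_crit q_crit = pi / (4 * z_crit * z) * ((z - z_crit)^4 + 2 / 3 * z_crit * z)"
    unfolding reduced_action_def t 4 q_crit_def using assms z_crit_pos
    by (simp add: field_simps power4_eq_xxxx power3_eq_cube power2_eq_square)
  also have "\<dots> = pi / 6 + pi / 4 * (1 / z_crit) * (z - z_crit)^4 / z"
    using assms z_crit_pos by (simp add: field_simps)
  also have "\<dots> = pi / 6 + 3 * pi / 2 * (z - z_crit)^4 / (z / z_crit)"
    unfolding z_crit_powers by simp
  finally show ?thesis .
qed

lemma energy_density_z_crit: "energy_density z_crit q_crit = 2 / 3"
  by (simp add: energy_density_def q_crit_def z_crit_square power_divide)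

lemma reduced_action_z_crit: "reduced_action z_crit \<tau>_crit q_crit = pi / 6"
  using reduced_action_crit[of z_crit] z_crit_pos by simp

text \<open>Since z (z - 2 a)^2 >= 0, the numerator keeps at least z/3. A linear lower bound without
  additive constant serves both as nonnegativity and as decay at infinity for every g > 0.\<close>

lemma reduced_action_ge_linear:
  assumes "z > 0"
  shows "reduced_action z \<tau>_crit q_crit \<ge> pi / (12 * z_crit) * z"
proof -
  have t: "2 * pi * \<tau>_crit = 4 * z_crit" "2 * \<tau>_crit = 4 * z_crit / pi"
    by (simp_all add: \<tau>_crit_def sqrt_6_z_crit z_crit_powers(4))
  have "z * (z - 2 * z_crit)\<^sup>2 \<ge> 0" using assms by simp
  also have "z * (z - 2 * z_crit)\<^sup>2 = z^3 - 4 * z_crit * z^2 + 4 * (z_crit * z_crit) * z"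
    by (simp add: algebra_simps power3_eq_cube power2_eq_square)
  finally have "z / 3 \<le> z + z^3 - 4 * z_crit * z^2" unfolding z_crit_powers by simp
  also have "\<dots> \<le> z + z^3 + q_crit\<^sup>2 / z - 4 * z_crit * z^2" using assms by simp
  finally have "z / 3 / (4 * z_crit / pi) \<le> reduced_action z \<tau>_crit q_crit"
    unfolding reduced_action_def t using z_crit_pos by (intro divide_right_mono) auto
  then show ?thesis by (simp add: field_simps)
qed

lemma reduced_action_expansion:
  "(\<lambda>\<delta>. reduced_action (z_crit + \<delta>) \<tau>_crit q_crit - pi / 6
          - (3 * pi / 2 * \<delta>^4 - 3 * pi * sqrt 6 / 2 * \<delta>^5 + 9 * pi * \<delta>^6))
        \<in> O[at 0](\<lambda>\<delta>. \<delta>^7)"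
\<comment> \<open>With x = \<delta>/a the polynomial is its leading term times 1 - x + x^2, the
  start of the geometric series of 1/(1+x), and the remainder is exactly -x^3/(1+x). For |x| < 1/2
  the factor 1/(1+x) is below 2, whence the constant.\<close>
proof (rule bigoI[where c = "3 * pi / z_crit ^ 3"])
  let ?a = z_crit
  have "eventually (\<lambda>\<delta>. dist \<delta> 0 < ?a / 2) (at 0)"
    unfolding eventually_at using z_crit_pos by (intro exI[of _ "?a / 2"]) auto
  then show "\<forall>\<^sub>F \<delta> in at 0. norm (reduced_action (z_crit + \<delta>) \<tau>_crit q_crit - pi / 6
          - (3 * pi / 2 * \<delta>^4 - 3 * pi * sqrt 6 / 2 * \<delta>^5 + 9 * pi * \<delta>^6))
        \<le> 3 * pi / z_crit ^ 3 * norm (\<delta>^7)"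
  proof eventually_elim
    case (elim \<delta>)
    define x where "x = \<delta> / ?a"
    have "\<bar>x\<bar> < 1 / 2" using elim z_crit_pos by (simp add: x_def dist_real_def field_simps)
    then have x: "1 + x > 1 / 2" by linarith
    have z: "(?a + \<delta>) / ?a = 1 + x" using z_crit_pos by (simp add: x_def field_simps)
    have \<delta>: "?a + \<delta> \<noteq> 0" using z x by force
    have s: "sqrt 6 * \<delta> = x" "6 * \<delta>\<^sup>2 = x\<^sup>2"
      by (simp_all add: sqrt_6_z_crit x_def power_divide z_crit_square)
    have "3 * pi / 2 * \<delta>^4 - 3 * pi * sqrt 6 / 2 * \<delta>^5 + 9 * pi * \<delta>^6
        = 3 * pi / 2 * \<delta>^4 * (1 - sqrt 6 * \<delta> + 6 * \<delta>\<^sup>2)"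
      by (simp add: algebra_simps eval_nat_numeral)
    then have poly: "3 * pi / 2 * \<delta>^4 - 3 * pi * sqrt 6 / 2 * \<delta>^5 + 9 * pi * \<delta>^6
        = 3 * pi / 2 * \<delta>^4 * (1 - x + x\<^sup>2)"
      unfolding s .
    have "reduced_action (z_crit + \<delta>) \<tau>_crit q_crit - pi / 6
          - (3 * pi / 2 * \<delta>^4 - 3 * pi * sqrt 6 / 2 * \<delta>^5 + 9 * pi * \<delta>^6)
        = 3 * pi / 2 * \<delta>^4 * (1 / (1 + x) - (1 - x + x\<^sup>2))"
      unfolding poly reduced_action_crit[OF \<delta>] z right_diff_distrib by simp
    also have "1 / (1 + x) - (1 - x + x\<^sup>2) = - (x^3 / (1 + x))"
      using x by (simp add: field_simps power2_eq_square power3_eq_cube)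
    also have "\<bar>3 * pi / 2 * \<delta>^4 * - (x^3 / (1 + x))\<bar> = 3 * pi / 2 * \<delta>^4 * (\<bar>x\<bar>^3 * (1 / (1 + x)))"
      using x by (simp add: abs_mult power_abs)
    also have "\<dots> \<le> 3 * pi / 2 * \<delta>^4 * (\<bar>x\<bar>^3 * 2)"
      using x by (intro mult_left_mono) (auto simp: field_simps)
    also have "\<dots> = 3 * pi / z_crit ^ 3 * \<bar>\<delta>^7\<bar>"
    proof -
      have "\<bar>\<delta>^7\<bar> = \<bar>\<delta>\<bar>^4 * \<bar>\<delta>\<bar>^3" using power_add[of "\<bar>\<delta>\<bar>" 4 3] by (simp add: power_abs)
      then show ?thesis using z_crit_pos by (simp add: x_def power_divide)
    qed
    finally show ?case by simp
  qed
qed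

section \<open>Integrability and amplitude expansions on the whole branch\<close>

lemma energy_density_measurable [measurable]: "(\<lambda>z. energy_density z q) \<in> borel_measurable borel"
  unfolding energy_density_def by measurable

lemma reduced_action_measurable [measurable]: "(\<lambda>z. reduced_action z \<tau> q) \<in> borel_measurable borel"
  unfolding reduced_action_def by measurable

lemma set_integrable_energy_density_exp:
  assumes c: "c > 0"
  shows "set_integrable lborel {z_ext q_crit<..}
           (\<lambda>z. energy_density z q_crit * exp (- c * reduced_action z \<tau>_crit q_crit))"
  unfolding set_integrable_def
proof (rule Bochner_Integration.integrable_bound)
  define c' where "c' = c * (pi / (12 * z_crit))"
  have c': "c' > 0" using c z_crit_pos by (simp add: c'_def)
  \<comment> \<open>The polynomial majorizes the density: the negative term with q^2/z^2 is
    dropped.\<close>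
  show "integrable lborel (\<lambda>z. poly [:1 / 2, 0, 3 / 2:] \<bar>z\<bar> * exp (- c' * \<bar>z\<bar>))"
    using c' by (rule integrable_poly_exp_minus_abs)
  show "AE z in lborel. norm (indicator {z_ext q_crit<..} z *\<^sub>R
          (energy_density z q_crit * exp (- c * reduced_action z \<tau>_crit q_crit)))
        \<le> norm (poly [:1 / 2, 0, 3 / 2:] \<bar>z\<bar> * exp (- c' * \<bar>z\<bar>))"
  proof (rule AE_I2)
    fix z
    show "norm (indicator {z_ext q_crit<..} z *\<^sub>R
          (energy_density z q_crit * exp (- c * reduced_action z \<tau>_crit q_crit)))
        \<le> norm (poly [:1 / 2, 0, 3 / 2:] \<bar>z\<bar> * exp (- c' * \<bar>z\<bar>))"
    proof (cases "z > z_ext q_crit")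
      case True
      then have z: "z > 0" using z_ext_crit(1) by linarith
      have "c' * z \<le> c * reduced_action z \<tau>_crit q_crit"
        unfolding c'_def mult.assoc using reduced_action_ge_linear[OF z] c by (intro mult_left_mono) auto
      moreover have "energy_density z q_crit \<le> poly [:1 / 2, 0, 3 / 2:] \<bar>z\<bar>"
        using z by (simp add: energy_density_def field_simps power2_eq_square)
      ultimately have "energy_density z q_crit * exp (- c * reduced_action z \<tau>_crit q_crit)
          \<le> poly [:1 / 2, 0, 3 / 2:] \<bar>z\<bar> * exp (- c' * \<bar>z\<bar>)"
        using z energy_density_pos[OF True] by (intro mult_mono) auto
      then show ?thesis using True energy_density_pos[OF True] by (simp add: abs_mult)
    qed simp
  qed
qed measurable

text \<open>The bound is global on the branch. The remainder divided by (z - a)^2 is the explicit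
  function 3/2 - a/z - 1/(12 z^2), bounded because z stays above \<open>z_ext q_crit\<close> >
  0.\<close>

lemma energy_density_expansion:
  "\<exists>K. \<forall>\<delta> > - (z_crit - z_ext q_crit).
     \<bar>energy_density (z_crit + \<delta>) q_crit - 2 / 3 - 4 * z_crit * \<delta>\<bar> \<le> K * \<delta>\<^sup>2"
proof (intro exI allI impI)
  let ?a = z_crit and ?b = "z_ext q_crit"
  fix \<delta> :: real assume "\<delta> > - (?a - ?b)"
  define z where "z = ?a + \<delta>"
  have z: "z > ?b" using \<open>\<delta> > _\<close> by (simp add: z_def)
  have b: "?b > 0" by (rule z_ext_crit(1))
  have z0: "z > 0" using z b by linarith
  have "(z - ?a)\<^sup>2 * (3 / 2 * z\<^sup>2 - ?a * z - ?a\<^sup>2 / 2)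
      = 3 / 2 * z^4 - 4 * ?a * z^3 + 3 * ?a\<^sup>2 * z\<^sup>2 - ?a^4 / 2"
    by (simp add: field_simps power4_eq_xxxx power3_eq_cube power2_eq_square)
  then have poly: "(z - ?a)\<^sup>2 * (3 / 2 * z\<^sup>2 - ?a * z - 1 / 12)
      = 3 / 2 * z^4 - 4 * ?a * z^3 + z\<^sup>2 / 2 - 1 / 72"
    unfolding z_crit_square z_crit_powers by simp
  have "energy_density z q_crit - 2 / 3 - 4 * ?a * (z - ?a)
      = (3 / 2 * z^4 - 4 * ?a * z^3 + (4 * (?a * ?a) - 1 / 6) * z\<^sup>2 - 1 / 72) / z\<^sup>2"
    using z0 by (simp add: energy_density_def q_crit_def field_simps power4_eq_xxxx power3_eq_cube power2_eq_square)
  also have "\<dots> = (z - ?a)\<^sup>2 * (3 / 2 * z\<^sup>2 - ?a * z - 1 / 12) / z\<^sup>2"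
    unfolding poly z_crit_powers by simp
  also have "\<dots> = (3 / 2 - ?a / z - 1 / (12 * z\<^sup>2)) * (z - ?a)\<^sup>2"
    using z0 by (simp add: field_simps power2_eq_square)
  finally have "\<bar>energy_density z q_crit - 2 / 3 - 4 * ?a * (z - ?a)\<bar>
      = \<bar>3 / 2 - ?a / z - 1 / (12 * z\<^sup>2)\<bar> * (z - ?a)\<^sup>2"
    by (simp add: abs_mult)
  also have "\<dots> \<le> (3 / 2 + ?a / ?b + 1 / (12 * ?b\<^sup>2)) * (z - ?a)\<^sup>2"
  proof (rule mult_right_mono)
    have "0 \<le> ?a / z" "?a / z \<le> ?a / ?b" "0 \<le> 1 / (12 * z\<^sup>2)"
      using z z0 b z_crit_pos by (auto intro!: divide_left_mono mult_pos_pos)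
    moreover have "1 / (12 * z\<^sup>2) \<le> 1 / (12 * ?b\<^sup>2)"
      using z z0 b by (intro divide_left_mono mult_left_mono power_mono) auto
    ultimately show "\<bar>3 / 2 - ?a / z - 1 / (12 * z\<^sup>2)\<bar> \<le> 3 / 2 + ?a / ?b + 1 / (12 * ?b\<^sup>2)"
      by linarith
  qed simp
  finally show "\<bar>energy_density (?a + \<delta>) q_crit - 2 / 3 - 4 * ?a * \<delta>\<bar>
      \<le> (3 / 2 + ?a / ?b + 1 / (12 * ?b\<^sup>2)) * \<delta>\<^sup>2"
    by (simp add: z_def)
qed

text \<open>Serves to absorb the factor 1/(1 + \<delta>/a) of the excess action into the amplitude:
  the value at 0 is kept, only the linear coefficient and the constant change.\<close>

lemma expansion_divide_one_plus:
  fixes f :: "real \<Rightarrow> real"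
  assumes f: "\<bar>f \<delta> - f0 - f1 * \<delta>\<bar> \<le> K * \<delta>\<^sup>2" and \<mu>: "0 < \<mu>" "\<mu> \<le> 1 + \<delta> / a"
  shows "\<bar>f \<delta> / (1 + \<delta> / a) - f0 - (f1 - f0 / a) * \<delta>\<bar> \<le> (K + \<bar>f0\<bar> / a\<^sup>2 + \<bar>f1 / a\<bar>) / \<mu> * \<delta>\<^sup>2"
proof -
  define x where "x = \<delta> / a"
  have x: "\<mu> \<le> 1 + x" "0 < 1 + x" using \<mu> by (auto simp: x_def)
  have f1: "(f1 - f0 / a) * \<delta> = f1 * \<delta> - f0 * x" by (simp add: x_def left_diff_distrib)
  have "f \<delta> / (1 + x) - f0 - (f1 - f0 / a) * \<delta>
      = ((f \<delta> - f0 - f1 * \<delta>) + f0 * x\<^sup>2 + (- f1 * \<delta> * x)) / (1 + x)"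
    unfolding f1 using x(2) by (simp add: field_simps power2_eq_square)
  then have "\<bar>f \<delta> / (1 + x) - f0 - (f1 - f0 / a) * \<delta>\<bar>
      = \<bar>(f \<delta> - f0 - f1 * \<delta>) + f0 * x\<^sup>2 + (- f1 * \<delta> * x)\<bar> / (1 + x)"
    using x(2) by simp
  also have "\<dots> \<le> (K * \<delta>\<^sup>2 + \<bar>f0\<bar> / a\<^sup>2 * \<delta>\<^sup>2 + \<bar>f1 / a\<bar> * \<delta>\<^sup>2) / (1 + x)"
  proof (intro divide_right_mono order_trans[OF abs_triangle_ineq] add_mono f)
    show "\<bar>f0 * x\<^sup>2\<bar> \<le> \<bar>f0\<bar> / a\<^sup>2 * \<delta>\<^sup>2" by (simp add: x_def abs_mult power_divide)
    have "\<bar>- f1 * \<delta> * x\<bar> = \<bar>f1 / a\<bar> * \<bar>\<delta> * \<delta>\<bar>" by (simp add: x_def abs_mult)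
    then show "\<bar>- f1 * \<delta> * x\<bar> \<le> \<bar>f1 / a\<bar> * \<delta>\<^sup>2" by (simp add: power2_eq_square)
  qed (use x in auto)
  also have "\<dots> \<le> (K * \<delta>\<^sup>2 + \<bar>f0\<bar> / a\<^sup>2 * \<delta>\<^sup>2 + \<bar>f1 / a\<bar> * \<delta>\<^sup>2) / \<mu>"
  proof (rule divide_left_mono)
    have "0 \<le> K * \<delta>\<^sup>2" using f by linarith
    then show "0 \<le> K * \<delta>\<^sup>2 + \<bar>f0\<bar> / a\<^sup>2 * \<delta>\<^sup>2 + \<bar>f1 / a\<bar> * \<delta>\<^sup>2" by simp
  qed (use x \<mu> in auto)
  also have "\<dots> = (K + \<bar>f0\<bar> / a\<^sup>2 + \<bar>f1 / a\<bar>) / \<mu> * \<delta>\<^sup>2"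
    by (simp add: algebra_simps)
  finally show ?thesis by (simp add: x_def)
qed

text \<open>Under z = \<open>z_crit\<close> + e t the weight becomes t^n, and the excess action
  divided by e^4 becomes the phase of \<open>quartic_laplace\<close> with d =
  \<open>z_crit - z_ext q_crit\<close>. The Jacobian e turns the error e^2 into e^3.\<close>

lemma critical_laplace:
  fixes f :: "real \<Rightarrow> real" and f0 f1 K :: real and n :: nat
  defines "\<phi> \<equiv> \<lambda>z. reduced_action z \<tau>_crit q_crit - pi / 6"
  assumes n: "even n"
    and [measurable]: "f \<in> borel_measurable borel"
    and f: "\<And>\<delta>. \<delta> > - (z_crit - z_ext q_crit) \<Longrightarrow> \<bar>f \<delta> - f0 - f1 * \<delta>\<bar> \<le> K * \<delta>\<^sup>2"
  shows "\<exists>C. \<forall>e. 0 < e \<and> e \<le> 1 \<longrightarrow>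
    \<bar>(LBINT z:{z_ext q_crit<..}. ((z - z_crit) / e) ^ n * f (z - z_crit) * exp (- \<phi> z / e^4))
       - f0 * ((3 * pi / 2) powr (- (real n + 1) / 4) * Gamma ((real n + 1) / 4) / 2) * e\<bar> \<le> C * e^3"
proof -
  let ?a = z_crit and ?b = "z_ext q_crit" and ?k = "3 * pi / 2"
  define m where "m = ?k powr (- (real n + 1) / 4) * Gamma ((real n + 1) / 4) / 2"
  define H where "H e t = indicator {- (?a - ?b)<..} (e * t) *
    (t ^ n * f (e * t) * exp (- (?k * t^4) / (1 + e * t / ?a)))" for e t
  have mom: "(\<integral>t. t ^ n * exp (- ?k * t^4) \<partial>lborel) = m"
    unfolding m_def using n by (intro quartic_gaussian_moment) auto
  obtain C where C: "\<And>e. 0 < e \<Longrightarrow> e \<le> 1 \<Longrightarrow> \<bar>(\<integral>t. H e t \<partial>lborel) - f0 * m\<bar> \<le> C * e\<^sup>2"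
    using quartic_laplace[of ?k "?a - ?b" ?a n f f0 f1 K] n f z_ext_crit unfolding mom H_def by auto
  have "\<bar>(LBINT z:{?b<..}. ((z - ?a) / e) ^ n * f (z - ?a) * exp (- \<phi> z / e^4)) - f0 * m * e\<bar> \<le> C * e^3"
    if e: "0 < e" "e \<le> 1" for e
  proof -
    let ?g = "\<lambda>z. ((z - ?a) / e) ^ n * f (z - ?a) * exp (- \<phi> z / e^4)"
    have H: "indicator {?b<..} (?a + e * t) * ?g (?a + e * t) = H e t" for t
    proof (cases "?a + e * t > ?b")
      case True
      then have "?a + e * t \<noteq> 0" using z_ext_crit(1) by linarith
      then have "\<phi> (?a + e * t) = e^4 * (?k * t^4 / ((?a + e * t) / ?a))"
        unfolding \<phi>_def by (subst reduced_action_crit) (auto simp: power_mult_distrib)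
      also have "(?a + e * t) / ?a = 1 + e * t / ?a"
        using z_crit_pos by (simp add: add_divide_distrib)
      finally have "- \<phi> (?a + e * t) / e^4 = - (?k * t^4) / (1 + e * t / ?a)"
        using e by (simp del: divide_divide_eq_right times_divide_eq_right)
      then show ?thesis using True e by (simp add: H_def)
    qed (simp add: H_def)
    have "(LBINT z:{?b<..}. ?g z) = \<bar>e\<bar> *\<^sub>R (\<integral>t. indicator {?b<..} (?a + e * t) *\<^sub>R ?g (?a + e * t) \<partial>lborel)"
      unfolding set_lebesgue_integral_def using e by (intro lborel_integral_real_affine) simp
    also have "\<dots> = e * (\<integral>t. H e t \<partial>lborel)"
      by (simp only: real_scaleR_def H abs_of_pos[OF e(1)])
    finally have "(LBINT z:{?b<..}. ?g z) - f0 * m * e = e * ((\<integral>t. H e t \<partial>lborel) - f0 * m)"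
      by (simp add: algebra_simps)
    then have "\<bar>(LBINT z:{?b<..}. ?g z) - f0 * m * e\<bar> = e * \<bar>(\<integral>t. H e t \<partial>lborel) - f0 * m\<bar>"
      using e by (simp add: abs_mult)
    also have "\<dots> \<le> e * (C * e\<^sup>2)"
      using C[OF e] e by (intro mult_left_mono) auto
    also have "\<dots> = C * e^3" by (simp add: power2_eq_square power3_eq_cube)
    finally show ?thesis .
  qed
  then show ?thesis unfolding m_def by blast
qed

section \<open>Zeroth and fourth moments at the critical point\<close>

lemma Gamma_quarter_pos: "Gamma (1 / 4 :: real) > 0"
  by (rule Gamma_real_pos) simp

lemma critical_partition_asymptotics:
  defines "\<phi> \<equiv> \<lambda>z. reduced_action z \<tau>_crit q_crit - pi / 6"
  shows "\<exists>C. \<forall>e. 0 < e \<and> e \<le> 1 \<longrightarrow>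
    \<bar>(LBINT z:{z_ext q_crit<..}. energy_density z q_crit * exp (- \<phi> z / e^4))
       - 2 / 3 * (Gamma (1 / 4) / 2) * (3 * pi / 2) powr (- 1 / 4) * e\<bar> \<le> C * e^3"
proof -
  obtain K where K: "\<And>\<delta>. \<delta> > - (z_crit - z_ext q_crit) \<Longrightarrow>
     \<bar>energy_density (z_crit + \<delta>) q_crit - 2 / 3 - 4 * z_crit * \<delta>\<bar> \<le> K * \<delta>\<^sup>2"
    using energy_density_expansion by blast
  have "(\<lambda>\<delta>. energy_density (z_crit + \<delta>) q_crit) \<in> borel_measurable borel" by measurable
  from critical_laplace[OF _ this K, of 0] show ?thesis
    by (simp add: \<phi>_def mult_ac)
qed

text \<open>The excess action over e^4 is (3 pi/2) t^4/(1 + \<delta>/a): its numerator makes this a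
  fourth moment, and its denominator joins the energy density in the amplitude.\<close>

lemma critical_action_asymptotics:
  defines "\<phi> \<equiv> \<lambda>z. reduced_action z \<tau>_crit q_crit - pi / 6"
  shows "\<exists>C. \<forall>e. 0 < e \<and> e \<le> 1 \<longrightarrow>
    \<bar>(LBINT z:{z_ext q_crit<..}. \<phi> z / e^4 * energy_density z q_crit * exp (- \<phi> z / e^4))
       - 1 / 4 * (2 / 3 * (Gamma (1 / 4) / 2) * (3 * pi / 2) powr (- 1 / 4) * e)\<bar> \<le> C * e^3"
proof -
  let ?a = z_crit and ?b = "z_ext q_crit" and ?k = "3 * pi / 2"
  obtain K where K: "\<And>\<delta>. \<delta> > - (?a - ?b) \<Longrightarrow>
     \<bar>energy_density (?a + \<delta>) q_crit - 2 / 3 - 4 * ?a * \<delta>\<bar> \<le> K * \<delta>\<^sup>2"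
    using energy_density_expansion by blast
  \<comment> \<open>On the branch 1 + \<delta>/a = z/a is at least
    \<open>z_ext q_crit / z_crit\<close>, which plays the role of \<mu> in
    \<open>expansion_divide_one_plus\<close>.\<close>
  define K' where "K' = (?k * K + \<bar>?k * (2 / 3)\<bar> / ?a\<^sup>2 + \<bar>?k * (4 * ?a) / ?a\<bar>) / (?b / ?a)"
  define f where "f \<delta> = ?k * energy_density (?a + \<delta>) q_crit / (1 + \<delta> / ?a)" for \<delta>
  have f: "\<bar>f \<delta> - ?k * (2 / 3) - (?k * (4 * ?a) - ?k * (2 / 3) / ?a) * \<delta>\<bar> \<le> K' * \<delta>\<^sup>2"
    if \<delta>: "\<delta> > - (?a - ?b)" for \<delta>
    unfolding f_def K'_def
  proof (rule expansion_divide_one_plus)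
    have "?k * energy_density (?a + \<delta>) q_crit - ?k * (2 / 3) - ?k * (4 * ?a) * \<delta>
       = ?k * (energy_density (?a + \<delta>) q_crit - 2 / 3 - 4 * ?a * \<delta>)"
      by (simp add: right_diff_distrib)
    then show "\<bar>?k * energy_density (?a + \<delta>) q_crit - ?k * (2 / 3) - ?k * (4 * ?a) * \<delta>\<bar> \<le> ?k * K * \<delta>\<^sup>2"
      using K[OF \<delta>] by (simp only: abs_mult) simp
    show "?b / ?a > 0" using z_ext_crit z_crit_pos by simp
    have "?b / ?a \<le> (?a + \<delta>) / ?a" using \<delta> z_crit_pos by (intro divide_right_mono) auto
    then show "?b / ?a \<le> 1 + \<delta> / ?a" using z_crit_pos by (simp add: add_divide_distrib)
  qed
  have meas: "f \<in> borel_measurable borel" unfolding f_def by measurable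
  obtain C where C: "\<And>e. 0 < e \<Longrightarrow> e \<le> 1 \<Longrightarrow>
    \<bar>(LBINT z:{?b<..}. ((z - ?a) / e) ^ 4 * f (z - ?a) * exp (- \<phi> z / e^4))
       - ?k * (2 / 3) * (?k powr (- 5 / 4) * Gamma (5 / 4) / 2) * e\<bar> \<le> C * e^3"
    using critical_laplace[OF _ meas f, of 4] by (auto simp: \<phi>_def)
  have eq: "((z - ?a) / e) ^ 4 * f (z - ?a) = \<phi> z / e^4 * energy_density z q_crit"
    if "z \<in> {?b<..}" for z e
  proof -
    have "z \<noteq> 0" using that z_ext_crit(1) by auto
    then have "\<phi> z = ?k * (z - ?a)^4 / (z / ?a)" unfolding \<phi>_def by (subst reduced_action_crit) auto
    moreover have "1 + (z - ?a) / ?a = z / ?a" using z_crit_pos by (simp add: field_simps)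
    ultimately show ?thesis by (simp add: f_def power_divide mult_ac)
  qed
  have int: "(LBINT z:{?b<..}. ((z - ?a) / e) ^ 4 * f (z - ?a) * exp (- \<phi> z / e^4))
    = (LBINT z:{?b<..}. \<phi> z / e^4 * energy_density z q_crit * exp (- \<phi> z / e^4))" for e
    using eq by (intro set_lebesgue_integral_cong) (auto simp del: times_divide_eq_left)
  \<comment> \<open>Compared with the zeroth moment, the fourth carries an extra 1/k, cancelled by
    the prefactor k of the excess action.\<close>
  have "?k * ?k powr (- 5 / 4) = ?k powr 1 * ?k powr (- 5 / 4)" by simp
  also have "\<dots> = ?k powr (- 1 / 4)" by (simp only: powr_add[symmetric]) simp
  finally have k: "?k * ?k powr (- 5 / 4) = ?k powr (- 1 / 4)" .
  have G: "Gamma (5 / 4) = 1 / 4 * Gamma (1 / 4 :: real)"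
    using Gamma_plus1[of "1 / 4 :: real"] nonpos_Ints_nonpos[of "1 / 4 :: real"] by auto
  have const: "?k * (2 / 3) * (?k powr (- 5 / 4) * Gamma (5 / 4) / 2) * e
      = 1 / 4 * (2 / 3 * (Gamma (1 / 4) / 2) * ?k powr (- 1 / 4) * e)" for e
  proof -
    have "?k * (2 / 3) * (?k powr (- 5 / 4) * Gamma (5 / 4) / 2) * e
        = (?k * ?k powr (- 5 / 4)) * (2 / 3) * Gamma (5 / 4) / 2 * e"
      by simp
    also have "\<dots> = 1 / 4 * (2 / 3 * (Gamma (1 / 4) / 2) * ?k powr (- 1 / 4) * e)"
      unfolding k G by simp
    finally show ?thesis .
  qed
  show ?thesis using C unfolding int const by blast
qed

section \<open>The partition function near s = 1\<close>

lemma Z_crit_eq: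
  assumes "g > 0"
  shows "Z_crit g s = exp (- s * pi / (6 * g)) * (LBINT z:{z_ext q_crit<..}.
    energy_density z q_crit * exp (- (reduced_action z \<tau>_crit q_crit - pi / 6) / (g / s)))"
proof -
  \<comment> \<open>Once the minimum pi/6 is split off, s enters only through g/s, so uniformity in
    s comes with the expansion in e.\<close>
  have eq: "exp (- s * r / g) = exp (- s * pi / (6 * g)) * exp (- (r - pi / 6) / (g / s))" for r
    using assms by (simp add: field_simps flip: exp_add)
  show ?thesis
    unfolding Z_crit_def
    by (subst set_integral_mult_right[symmetric]) (simp only: eq mult.left_commute)
qed

lemma fourth_root_powers:
  fixes x :: real
  assumes "x > 0"
  shows "(x powr (1 / 4)) ^ 4 = x" "(x powr (1 / 4))\<^sup>2 = x powr (1 / 2)"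
  using assms powr_powr[of x "1 / 4" 4] powr_powr[of x "1 / 4" 2]
  by (auto simp flip: powr_numeral)

lemma Z_crit_asymptotics:
  "\<exists>\<epsilon> > 0. \<exists>g\<^sub>0 > 0. \<exists>C. \<forall>s g. \<bar>s - 1\<bar> < \<epsilon> \<and> 0 < g \<and> g < g\<^sub>0 \<longrightarrow>
        (\<exists>R. \<bar>R\<bar> \<le> C * g powr (1/2) \<and>
           Z_crit g s = exp (- s * pi / (6 * g)) * (2 / 3) * (Gamma (1/4) / 2)
                          * (2 * g / (3 * pi * s)) powr (1/4) * (1 + R))"
proof -
  define \<phi> where "\<phi> z = reduced_action z \<tau>_crit q_crit - pi / 6" for z
  define A where "A e = (LBINT z:{z_ext q_crit<..}. energy_density z q_crit * exp (- \<phi> z / e^4))" for e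
  define m where "m = 2 / 3 * (Gamma (1 / 4) / 2) * (3 * pi / 2) powr (- 1 / 4)"
  have m: "m > 0" using Gamma_quarter_pos by (simp add: m_def)
  obtain C where C: "\<And>e. 0 < e \<Longrightarrow> e \<le> 1 \<Longrightarrow> \<bar>A e - m * e\<bar> \<le> C * e^3"
    using critical_partition_asymptotics unfolding A_def m_def \<phi>_def by blast
  have C0: "C \<ge> 0" using C[of 1] by simp
  have "\<exists>R. \<bar>R\<bar> \<le> (2 * C / m) * g powr (1/2) \<and>
           Z_crit g s = exp (- s * pi / (6 * g)) * (2 / 3) * (Gamma (1/4) / 2)
                          * (2 * g / (3 * pi * s)) powr (1/4) * (1 + R)"
    \<comment> \<open>With s > 1/2 and g < 1/2 the parameter e^4 = g/s is at most 1 and at most 2 g,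
      which makes the constant independent of s.\<close>
    if h: "\<bar>s - 1\<bar> < 1 / 2" "0 < g" "g < 1 / 2" for s g
  proof -
    have s: "s > 1 / 2" using h(1) by linarith
    define e where "e = (g / s) powr (1 / 4)"
    have gs: "0 < g / s" "g / s \<le> 1" "g / s \<le> 2 * g" using s h by (auto simp: field_simps)
    have e: "0 < e" "e \<le> 1" using gs by (auto simp: e_def intro: powr_le1)
    have e4: "e^4 = g / s" and e2: "e\<^sup>2 = (g / s) powr (1 / 2)"
      unfolding e_def using gs(1) by (rule fourth_root_powers)+
    have "e\<^sup>2 \<le> (2 * g) powr (1 / 2)" unfolding e2 using gs by (intro powr_mono2) auto
    also have "\<dots> = 2 powr (1 / 2) * g powr (1 / 2)" using h by (simp add: powr_mult)
    also have "\<dots> \<le> 2 powr 1 * g powr (1 / 2)" by (intro mult_right_mono powr_mono) auto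
    finally have e2': "e\<^sup>2 \<le> 2 * g powr (1 / 2)" by simp
    define R where "R = (A e - m * e) / (m * e)"
    have "\<bar>R\<bar> = \<bar>A e - m * e\<bar> / (m * e)" using m e by (simp add: R_def abs_mult)
    also have "\<dots> \<le> C * e^3 / (m * e)" using C[OF e] m e by (intro divide_right_mono) auto
    also have "\<dots> = C / m * e\<^sup>2" using m e by (simp add: field_simps power2_eq_square power3_eq_cube)
    also have "\<dots> \<le> C / m * (2 * g powr (1 / 2))" using e2' C0 m by (intro mult_left_mono) auto
    finally have R: "\<bar>R\<bar> \<le> (2 * C / m) * g powr (1/2)" by (simp add: mult_ac)
    have "2 * g / (3 * pi * s) = (g / s) * inverse (3 * pi / 2)" by (simp add: field_simps)
    then have "(2 * g / (3 * pi * s)) powr (1 / 4) = e * inverse (3 * pi / 2) powr (1 / 4)"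
      unfolding e_def using gs by (simp only: powr_mult)
    also have "inverse (3 * pi / 2) powr (1 / 4) = (3 * pi / 2) powr (- 1 / 4)"
      by (simp only: inverse_powr) (simp add: powr_minus)
    finally have p: "(2 * g / (3 * pi * s)) powr (1 / 4) = e * (3 * pi / 2) powr (- 1 / 4)" .
    have "A e = m * e * (1 + R)" using m e by (simp add: R_def field_simps)
    moreover have "Z_crit g s = exp (- s * pi / (6 * g)) * A e"
      using Z_crit_eq[OF h(2), of s] by (simp add: A_def \<phi>_def e4)
    ultimately have "Z_crit g s = exp (- s * pi / (6 * g)) * (2 / 3) * (Gamma (1/4) / 2)
                          * (2 * g / (3 * pi * s)) powr (1/4) * (1 + R)"
      unfolding p m_def by simp
    then show ?thesis using R by blast
  qed
  then show ?thesis
    by (intro exI[of _ "1 / 2"] conjI exI[of _ "2 * C / m"]) auto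
qed

section \<open>Positivity, the logarithmic derivative and the mean free energy\<close>

lemma Z_crit_pos:
  assumes "g > 0" "s > 0"
  shows "Z_crit g s > 0"
proof -
  let ?b = "z_ext q_crit"
  let ?f = "\<lambda>z. indicator {?b<..} z *\<^sub>R (energy_density z q_crit * exp (- s * reduced_action z \<tau>_crit q_crit / g))"
  have int: "integrable lborel ?f"
    using set_integrable_energy_density_exp[of "s / g"] assms by (simp add: set_integrable_def)
  have nonneg: "?f z \<ge> 0" for z using energy_density_pos[of z] by (auto simp: indicator_def)
  have "(\<integral>z. ?f z \<partial>lborel) \<noteq> 0"
  proof
    assume "(\<integral>z. ?f z \<partial>lborel) = 0"
    then have "AE z in lborel. ?f z = 0"
      using integral_nonneg_eq_0_iff_AE[OF int] nonneg by auto
    \<comment> \<open>The integrand is strictly positive on this interval of length 1, which has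
      nonzero measure.\<close>
    then have "AE z in lborel. z \<notin> {?b<..<?b + 1}"
      by eventually_elim (use energy_density_pos in \<open>force simp: indicator_def\<close>)
    then have "emeasure lborel {?b<..<?b + 1} = 0"
      by (subst (asm) AE_iff_null_sets[symmetric]) auto
    then show False by simp
  qed
  moreover have "(\<integral>z. ?f z \<partial>lborel) \<ge> 0" using nonneg by (rule Bochner_Integration.integral_nonneg)
  ultimately show ?thesis by (simp add: Z_crit_def set_lebesgue_integral_def)
qed

lemma reduced_action_nonneg:
  assumes "z > z_ext q_crit"
  shows "reduced_action z \<tau>_crit q_crit \<ge> 0"
proof -
  have "z > 0" using assms z_ext_crit(1) by linarith
  then have "0 \<le> pi / (12 * z_crit) * z" using z_crit_pos by simp
  also have "\<dots> \<le> reduced_action z \<tau>_crit q_crit" by (rule reduced_action_ge_linear) fact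
  finally show ?thesis .
qed

text \<open>Proved at each fixed g. The integrability at a quarter of the rate holds because the
  density is integrable against every positive multiple of the action.\<close>

lemma Z_crit_derivative:
  assumes g: "g > 0"
  defines "N \<equiv> LBINT z:{z_ext q_crit<..}. reduced_action z \<tau>_crit q_crit / g * energy_density z q_crit
                * exp (- reduced_action z \<tau>_crit q_crit / g)"
  shows "set_integrable lborel {z_ext q_crit<..} (\<lambda>z. reduced_action z \<tau>_crit q_crit / g
             * energy_density z q_crit * exp (- reduced_action z \<tau>_crit q_crit / g))"
    and "((\<lambda>s. Z_crit g s) has_real_derivative - N) (at 1)"
proof -
  let ?S = "{z_ext q_crit<..}"
  define w where "w z = indicator ?S z * energy_density z q_crit" for z
  define J where "J z = reduced_action z \<tau>_crit q_crit / g" for z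
  have [measurable]: "w \<in> borel_measurable lborel" "J \<in> borel_measurable lborel"
    unfolding w_def J_def by measurable
  have J: "J z \<ge> 0" if "w z \<noteq> 0" for z
    using that reduced_action_nonneg[of z] g by (auto simp: w_def J_def indicator_def split: if_splits)
  have "integrable lborel (\<lambda>z. w z * exp (- J z / 4))"
    using set_integrable_energy_density_exp[of "1 / (4 * g)"] g
    by (simp add: set_integrable_def w_def J_def mult_ac)
  note * = laplace_integral_has_derivative[OF _ _ J this]
  have eq: "w z * J z * exp (- J z) = indicator ?S z *\<^sub>R (reduced_action z \<tau>_crit q_crit / g
             * energy_density z q_crit * exp (- reduced_action z \<tau>_crit q_crit / g))" for z
    by (simp add: w_def J_def)
  have eqZ: "Z_crit g s = (\<integral>z. w z * exp (- s * J z) \<partial>lborel)" for s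
    by (simp add: Z_crit_def set_lebesgue_integral_def w_def J_def mult_ac)
  show "set_integrable lborel ?S (\<lambda>z. reduced_action z \<tau>_crit q_crit / g
             * energy_density z q_crit * exp (- reduced_action z \<tau>_crit q_crit / g))"
    using *(1) unfolding set_integrable_def eq by simp
  show "((\<lambda>s. Z_crit g s) has_real_derivative - N) (at 1)"
    using *(2) unfolding eqZ eq N_def set_lebesgue_integral_def by simp
qed

lemma F_bar_eq:
  "F_bar L g = T_crit L * (LBINT z:{z_ext q_crit<..}. reduced_action z \<tau>_crit q_crit / g
      * energy_density z q_crit * exp (- reduced_action z \<tau>_crit q_crit / g)) / Z_crit g 1"
  by (simp add: F_bar_def F_avg_def Z_crit_def T_crit_def F_gen_def euclidean_action_def mult.assoc)

lemma F_crit_eq: "F_crit L g = T_crit L * pi / (6 * g)"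
  by (simp add: F_crit_def F_gen_def euclidean_action_def T_crit_def reduced_action_z_crit)

text \<open>The constant pi/6 of the action contributes exactly \<open>F_crit\<close> to the mean,
  so the shift over \<open>T_crit\<close> is the quotient of B by A at e = g^(1/4). Their leading
  terms have ratio 1/4, and both have relative error e^2.\<close>

lemma free_energy_shift_asymptotics:
  assumes L: "L > 0"
  shows "(\<lambda>g. (F_bar L g - F_crit L g) / T_crit L - 1 / 4) \<in> O[at_right 0](\<lambda>g. g powr (1/2))"
proof -
  define \<phi> where "\<phi> z = reduced_action z \<tau>_crit q_crit - pi / 6" for z
  let ?S = "{z_ext q_crit<..}"
  define A where "A e = (LBINT z:?S. energy_density z q_crit * exp (- \<phi> z / e^4))" for e
  define B where "B e = (LBINT z:?S. \<phi> z / e^4 * energy_density z q_crit * exp (- \<phi> z / e^4))" for e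
  define m where "m = 2 / 3 * (Gamma (1 / 4) / 2) * (3 * pi / 2) powr (- 1 / 4)"
  have m: "m > 0" using Gamma_quarter_pos by (simp add: m_def)
  obtain C where C: "\<And>e. 0 < e \<Longrightarrow> e \<le> 1 \<Longrightarrow> \<bar>A e - m * e\<bar> \<le> C * e^3"
    using critical_partition_asymptotics unfolding A_def m_def \<phi>_def by blast
  obtain C' where C': "\<And>e. 0 < e \<Longrightarrow> e \<le> 1 \<Longrightarrow> \<bar>B e - 1 / 4 * (m * e)\<bar> \<le> C' * e^3"
    using critical_action_asymptotics unfolding B_def m_def \<phi>_def by blast
  have C0: "C \<ge> 0" "C' \<ge> 0" using C[of 1] C'[of 1] by simp_all
  \<comment> \<open>Ensures C e^2 <= m/2, hence A e >= m e / 2 for the denominator; C + 1 stands in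
    for C, which could be 0.\<close>
  define g0 where "g0 = min 1 ((m / (2 * (C + 1)))\<^sup>2)"
  have g0: "g0 > 0" using m C0 by (simp add: g0_def)
  have T: "T_crit L > 0" using L by (simp add: T_crit_def \<tau>_crit_def)
  have bound: "\<bar>(F_bar L g - F_crit L g) / T_crit L - 1 / 4\<bar> \<le> (2 * (C' + C) / m) * g powr (1/2)"
    if g: "0 < g" "g < g0" for g
  proof -
    define e where "e = g powr (1 / 4)"
    have e4: "e^4 = g" and e2: "e\<^sup>2 = g powr (1 / 2)"
      unfolding e_def using g(1) by (rule fourth_root_powers)+
    have e: "0 < e" "e \<le> 1" using g by (auto simp: e_def g0_def intro: powr_le1)
    let ?N = "LBINT z:?S. reduced_action z \<tau>_crit q_crit / g * energy_density z q_crit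
                * exp (- reduced_action z \<tau>_crit q_crit / g)"
    have ZA: "Z_crit g 1 = exp (- pi / (6 * g)) * A e"
      using Z_crit_eq[OF g(1), of 1] by (simp add: A_def \<phi>_def e4)
    have A: "A e > 0" using Z_crit_pos[OF g(1), of 1] by (simp add: ZA zero_less_mult_iff)
    have N: "?N = pi / (6 * g) * Z_crit g 1 + exp (- pi / (6 * g)) * B e"
    proof -
      have i1: "set_integrable lborel ?S (\<lambda>z. energy_density z q_crit * exp (- 1 * reduced_action z \<tau>_crit q_crit / g))"
        using set_integrable_energy_density_exp[of "1 / g"] g by simp
      have i2: "set_integrable lborel ?S (\<lambda>z. reduced_action z \<tau>_crit q_crit / g
             * energy_density z q_crit * exp (- reduced_action z \<tau>_crit q_crit / g))"
        using g(1) by (rule Z_crit_derivative(1))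
      have "?N - pi / (6 * g) * Z_crit g 1 = (LBINT z:?S. reduced_action z \<tau>_crit q_crit / g
             * energy_density z q_crit * exp (- reduced_action z \<tau>_crit q_crit / g)
             - pi / (6 * g) * (energy_density z q_crit * exp (- 1 * reduced_action z \<tau>_crit q_crit / g)))"
        unfolding Z_crit_def using i1 i2 by (simp add: set_integral_diff)
      also have "\<dots> = (LBINT z:?S. exp (- pi / (6 * g)) *
             (\<phi> z / e^4 * energy_density z q_crit * exp (- \<phi> z / e^4)))"
      proof -
        have "r / g * d * exp (- r / g) - pi / (6 * g) * (d * exp (- 1 * r / g))
            = exp (- pi / (6 * g)) * ((r - pi / 6) / g * d * exp (- (r - pi / 6) / g))" for r d
        proof -
          have "exp (- r / g) = exp (- pi / (6 * g)) * exp (- (r - pi / 6) / g)"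
            using g by (simp add: field_simps flip: exp_add)
          then show ?thesis by (simp add: diff_divide_distrib algebra_simps)
        qed
        then show ?thesis by (simp only: \<phi>_def e4)
      qed
      also have "\<dots> = exp (- pi / (6 * g)) * B e" by (simp add: B_def)
      finally show ?thesis by simp
    qed
    have "(F_bar L g - F_crit L g) / T_crit L = ?N / Z_crit g 1 - pi / (6 * g)"
      using T by (simp add: F_bar_eq F_crit_eq field_simps)
    also have "\<dots> = B e / A e"
      unfolding N using A by (simp add: ZA field_simps)
    also have "B e / A e - 1 / 4 = (B e - A e / 4) / A e"
      using A by (simp add: field_simps)
    finally have "(F_bar L g - F_crit L g) / T_crit L - 1 / 4 = (B e - A e / 4) / A e" .
    then have "\<bar>(F_bar L g - F_crit L g) / T_crit L - 1 / 4\<bar> = \<bar>B e - A e / 4\<bar> / A e"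
      using A by simp
    also have "\<dots> \<le> ((C' + C) * e^3) / (m * e / 2)"
    proof (rule frac_le)
      \<comment> \<open>The leading terms m e / 4 cancel, leaving only the two cubic errors.\<close>
      have "\<bar>B e - A e / 4\<bar> \<le> C' * e^3 + C * e^3 / 4"
        using C[OF e] C'[OF e] by linarith
      also have "\<dots> \<le> (C' + C) * e^3" using C0 e by (simp add: algebra_simps)
      finally show "\<bar>B e - A e / 4\<bar> \<le> (C' + C) * e^3" .
      have "e\<^sup>2 \<le> ((m / (2 * (C + 1)))\<^sup>2) powr (1 / 2)"
        unfolding e2 using g by (intro powr_mono2) (auto simp: g0_def)
      also have "\<dots> = m / (2 * (C + 1))" using m C0 by (simp add: powr_half_sqrt)
      finally have "(C + 1) * e\<^sup>2 \<le> m / 2" using C0 by (simp add: field_simps)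
      then have "C * e\<^sup>2 \<le> m / 2" by (simp add: algebra_simps) (smt (verit) zero_le_power2)
      then have "e * (C * e\<^sup>2) \<le> e * (m / 2)" using e by (intro mult_left_mono) auto
      then show "m * e / 2 \<le> A e" using C[OF e] by (simp add: power2_eq_square power3_eq_cube algebra_simps)
    qed (use m e C0 in auto)
    also have "\<dots> = (2 * (C' + C) / m) * g powr (1/2)"
      using e m by (simp add: field_simps power2_eq_square power3_eq_cube flip: e2)
    finally show ?thesis .
  qed
  show ?thesis
  proof (rule bigoI)
    show "\<forall>\<^sub>F g in at_right 0. norm ((F_bar L g - F_crit L g) / T_crit L - 1 / 4)
        \<le> (2 * (C' + C) / m) * norm (g powr (1/2))"
      unfolding eventually_at_right_field using g0 bound by (intro exI[of _ g0]) auto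
  qed
qed

theorem mainTheorem4:
  fixes L :: real
  assumes "L > 0"
  shows
    "z_ext q_crit < z_crit
   \<and> (\<forall>z > z_ext q_crit. energy_density z q_crit > 0)
   \<and> energy_density z_crit q_crit = 2 / 3
   \<and> reduced_action z_crit \<tau>_crit q_crit = pi / 6
   \<and> (\<lambda>\<delta>. reduced_action (z_crit + \<delta>) \<tau>_crit q_crit - pi / 6
          - (3 * pi / 2 * \<delta>^4 - 3 * pi * sqrt 6 / 2 * \<delta>^5 + 9 * pi * \<delta>^6))
        \<in> O[at 0](\<lambda>\<delta>. \<delta>^7)
   \<and> (\<forall>g > 0. \<forall>s > 0. set_integrable lborel {z_ext q_crit<..}
        (\<lambda>z. energy_density z q_crit * exp (- s * reduced_action z \<tau>_crit q_crit / g)))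
   \<and> (\<exists>\<epsilon> > 0. \<exists>g\<^sub>0 > 0. \<exists>C. \<forall>s g. \<bar>s - 1\<bar> < \<epsilon> \<and> 0 < g \<and> g < g\<^sub>0 \<longrightarrow>
        (\<exists>R. \<bar>R\<bar> \<le> C * g powr (1/2) \<and>
           Z_crit g s = exp (- s * pi / (6 * g)) * (2 / 3) * (Gamma (1/4) / 2)
                          * (2 * g / (3 * pi * s)) powr (1/4) * (1 + R)))
   \<and> (\<forall>g > 0. F_crit L g = T_crit L * pi / (6 * g))
   \<and> (\<forall>g > 0. set_integrable lborel {z_ext q_crit<..}
        (\<lambda>z. F_gen L g \<tau>_crit q_crit z * energy_density z q_crit
              * exp (- euclidean_action g \<tau>_crit q_crit z)))
   \<and> (\<forall>g > 0. \<exists>D. ((\<lambda>s. ln (Z_crit g s)) has_real_derivative D) (at 1)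
                 \<and> F_bar L g = - T_crit L * D)
   \<and> (\<lambda>g. (F_bar L g - F_crit L g) / T_crit L - 1 / 4) \<in> O[at_right 0](\<lambda>g. g powr (1/2))"
proof (intro conjI allI impI)
  fix g s :: real assume "g > 0" "s > 0"
  then show "set_integrable lborel {z_ext q_crit<..}
        (\<lambda>z. energy_density z q_crit * exp (- s * reduced_action z \<tau>_crit q_crit / g))"
    using set_integrable_energy_density_exp[of "s / g"] by simp
next
  fix g :: real assume g: "g > 0"
  show "set_integrable lborel {z_ext q_crit<..}
        (\<lambda>z. F_gen L g \<tau>_crit q_crit z * energy_density z q_crit
              * exp (- euclidean_action g \<tau>_crit q_crit z))"
    using set_integrable_mult_right[of "\<tau>_crit / L", OF Z_crit_derivative(1)[OF g]]
    by (simp add: F_gen_def euclidean_action_def mult.assoc)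
  show "\<exists>D. ((\<lambda>s. ln (Z_crit g s)) has_real_derivative D) (at 1) \<and> F_bar L g = - T_crit L * D"
    \<comment> \<open>The witness D is left open and fixed by the chain rule as -N/Z, with N the
      integral in \<open>Z_crit_derivative\<close>; the second conjunct is then the formula for
      \<open>F_bar\<close>.\<close>
    by (intro exI conjI)
       (rule DERIV_chain2[OF DERIV_ln[OF Z_crit_pos] Z_crit_derivative(2)[OF g]],
         use g in \<open>auto simp: F_bar_eq field_simps\<close>)
qed (use assms z_ext_crit energy_density_pos energy_density_z_crit reduced_action_z_crit
       reduced_action_expansion Z_crit_asymptotics F_crit_eq free_energy_shift_asymptotics in auto)

end
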